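(* Let $M=(M_k)\in\mathbb R_{>0}^{\mathbb N}$ and let $U\subseteq\mathbb R^n$ be open. (1) If $\liminf_k M_k^{1/k}>0$ then $\mathcal E^{\{M\}}(U)=\mathcal E^{\{M^{b(c)}\}}(U)$. (2) If $\lim_k M_k^{1/k}=\infty$ then $\mathcal E^{(M)}(U)=\mathcal E^{(M^{b(c)})}(U)$. Under the assumption of (1), $\mathcal E^{\{M\}}(U)$ is an algebra, and under the assumption of (2), $\mathcal E^{(M)}(U)$ is an algebra.
   Context: For $M\in\mathbb R_{>0}^{\mathbb N}$, open $U\subseteq\mathbb R^n$, compact $K\subseteq U$, $\rho>0$ and $f\in C^\infty(U,\mathbb R)$ let $\|f\|^M_{K,\rho}:=\sup\{\|f^{(k)}(x)\|_{L^k(\mathbb R^n,\mathbb R)}/(k!\rho^kM_k):x\in K,k\in\mathbb N\}$ ($f^{(k)}$ the $k$-th Fréchet derivative). $\mathcal E^{(M)}(U)$: smooth $f$ with $\|f\|^M_{K,\rho}<\infty$ for all compact $K\subseteq U$ and all $\rho>0$; $\mathcal E^{\{M\}}(U)$: smooth $f$ such that for every compact $K$ some $\rho>0$ gives $\|f\|^M_{K,\rho}<\infty$. For $M$ with $(k!M_k)^{1/k}\to\infty$ (which holds under either hypothesis), $T_M(t):=\sup_{k}t^k/(k!M_k)$ for $t>0$ and $M^{b(c)}_k:=\frac1{k!}\sup_{t>0}t^k/T_M(t)$; $(k!M^{b(c)}_k)_k$ is the largest log-convex minorant of $(k!M_k)_k$. *)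

theory Defs
  imports "HOL-Analysis.Analysis"
begin

text \<open>Iterated directional Frechet derivative:
  iter_deriv f [v1,...,vk] x = f^(k)(x)(v1,...,vk) (order of differentiation irrelevant for smooth f).\<close>
fun iter_deriv :: "('a::real_normed_vector \<Rightarrow> real) \<Rightarrow> 'a list \<Rightarrow> 'a \<Rightarrow> real" where
  "iter_deriv f [] = f"
| "iter_deriv f (v # vs) = (\<lambda>x. frechet_derivative (iter_deriv f vs) (at x) v)"

definition smooth_on :: "'a::real_normed_vector set \<Rightarrow> ('a \<Rightarrow> real) \<Rightarrow> bool" where
  "smooth_on U f \<longleftrightarrow> (\<forall>vs. \<forall>x\<in>U. iter_deriv f vs differentiable (at x))"

definition deriv_norm :: "('a::real_normed_vector \<Rightarrow> real) \<Rightarrow> nat \<Rightarrow> 'a \<Rightarrow> real" where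
  "deriv_norm f k x = (SUP vs \<in> {vs. length vs = k \<and> (\<forall>v\<in>set vs. norm v \<le> 1)}. \<bar>iter_deriv f vs x\<bar>)"

definition seminorm_finite ::
  "(nat \<Rightarrow> real) \<Rightarrow> 'a::real_normed_vector set \<Rightarrow> real \<Rightarrow> ('a \<Rightarrow> real) \<Rightarrow> bool" where
  "seminorm_finite M K \<rho> f \<longleftrightarrow>
     bdd_above {deriv_norm f k x / (fact k * \<rho> ^ k * M k) | x k. x \<in> K}"

definition beurling :: "(nat \<Rightarrow> real) \<Rightarrow> 'a::real_normed_vector set \<Rightarrow> ('a \<Rightarrow> real) set" where
  "beurling M U = {f. smooth_on U f \<and>
     (\<forall>K. compact K \<and> K \<subseteq> U \<longrightarrow> (\<forall>\<rho>>0. seminorm_finite M K \<rho> f))}"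

definition roumieu :: "(nat \<Rightarrow> real) \<Rightarrow> 'a::real_normed_vector set \<Rightarrow> ('a \<Rightarrow> real) set" where
  "roumieu M U = {f. smooth_on U f \<and>
     (\<forall>K. compact K \<and> K \<subseteq> U \<longrightarrow> (\<exists>\<rho>>0. seminorm_finite M K \<rho> f))}"

definition T_M :: "(nat \<Rightarrow> real) \<Rightarrow> real \<Rightarrow> real" where
  "T_M M t = (SUP k. t ^ k / (fact k * M k))"

definition M_bc :: "(nat \<Rightarrow> real) \<Rightarrow> nat \<Rightarrow> real" where
  "M_bc M k = (1 / fact k) * (SUP t \<in> {0<..}. t ^ k / T_M M t)"

definition is_fun_algebra :: "('a \<Rightarrow> real) set \<Rightarrow> bool" where
  "is_fun_algebra A \<longleftrightarrow> (\<lambda>x. 1) \<in> A \<and>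
     (\<forall>f\<in>A. \<forall>g\<in>A. (\<lambda>x. f x + g x) \<in> A \<and> (\<lambda>x. f x * g x) \<in> A) \<and>
     (\<forall>c. \<forall>f\<in>A. (\<lambda>x. c * f x) \<in> A)"

end

theory Submission
  imports Defs "HOL-Complex_Analysis.Complex_Analysis"
begin

text \<open>
  Put \<open>m k = k! M k\<close> and \<open>b k = k! M_bc M k \<le> m k\<close>. For every \<open>k > 0\<close> there are \<open>p < k \<le> q\<close> and \<open>t > 0\<close>
  such that \<open>m q = t\<^bsup>q-p\<^esup> m p\<close> and \<open>b k \<ge> t\<^bsup>k-p\<^esup> m p\<close>. Bounds on the derivatives of orders \<open>p\<close> and \<open>q\<close> are
  interpolated to order \<open>k\<close> by an inequality of Cartan--Gorny type, which is applied on balls of a fixed radius;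
  this is possible because \<open>M k \<ge> L\<^sup>k\<close> for large \<open>k\<close> forces \<open>t \<ge> c L q\<close>. The interpolation inequality
  follows from Taylor's formula and an estimate for the derivatives of a polynomial in the middle of an interval.
  Finally \<open>b i * b j \<le> b 0 * b (i + j)\<close>, so that the Leibniz rule shows that the classes are algebras.
\<close>

section \<open>Interpolation of derivatives in one variable\<close>

text \<open>With \<open>A = C * \<rho> ^ p * m p\<close>, the relation between \<open>m p\<close>
  and \<open>m q\<close> says that the derivatives of orders \<open>p\<close> and \<open>q\<close>
  are bounded by \<open>A\<close> and \<open>A * (\<rho> * t) ^ (q - p)\<close>. Interpolation
  returns \<open>A * (const * \<rho> * t) ^ (k - p)\<close> at order \<open>k\<close>, which is what
  \<open>b k\<close> permits. The obstacle is the bounded domain: on a ball of radius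
  \<open>e\<close> the loss stays geometric in \<open>k - p\<close> as long as \<open>q - p\<close>
  is at most \<open>\<rho> * t * e / DIM\<close>. Inserting the lower bound for \<open>t\<close>
  cancels \<open>q\<close> and leaves a condition on the product \<open>\<rho> * e * L\<close>
  alone. In the Roumieu case \<open>L\<close> is fixed and \<open>\<rho>\<close> is enlarged; in the
  Beurling case \<open>\<rho>\<close> is prescribed and \<open>L\<close> may be as large as
  required. For the latter it is essential that \<open>\<rho>\<close> is lost only by a factor
  depending on the dimension. The origin of \<open>b\<close> is a double Legendre transform:
  \<open>ln (T_M M t)\<close> is conjugate to \<open>ln (m k)\<close> in the variable
  \<open>ln t\<close>.\<close>

lemma joukowski_preimage:
  fixes z :: complex
  obtains w where "w \<noteq> 0" "norm w \<le> 1" "z = (w + 1 / w) / 2" "1 / norm w \<le> 1 + 2 * norm z"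
proof -
  note preimage = that
  have key: thesis if ab: "a * b = 1" "a + b = 2 * z" "norm a \<le> 1" for a b
  proof (rule preimage)
    show "a \<noteq> 0" using ab(1) by auto
    then have b: "1 / a = b" using ab(1) by (simp add: field_simps)
    show "norm a \<le> 1" by fact
    show "z = (a + 1 / a) / 2" using b ab(2) by simp
    have "1 / norm a = norm b" using b by (metis norm_divide norm_one)
    also have "norm b \<le> norm (a + b) + norm a"
      by (metis add.commute add_diff_cancel_right' norm_triangle_ineq4)
    finally show "1 / norm a \<le> 1 + 2 * norm z" using ab(2,3) by (simp add: norm_mult)
  qed
  \<comment> \<open>The roots of \<open>w^2 - 2 * z * w + 1\<close> have product 1, so one of them
    lies in the closed unit disc, and \<open>key\<close> applies with that root in first
    place.\<close>
  define a b where "a = z + csqrt (z\<^sup>2 - 1)" and "b = z - csqrt (z\<^sup>2 - 1)"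
  have "a * b = z\<^sup>2 - (csqrt (z\<^sup>2 - 1))\<^sup>2"
    unfolding a_def b_def by (simp only: power2_eq_square algebra_simps)
  then have ab: "a * b = 1" "a + b = 2 * z"
    unfolding power2_csqrt by (simp_all add: a_def b_def)
  have "norm a * norm b = 1" by (metis ab(1) norm_mult norm_one)
  then have "norm a \<le> 1 \<or> norm b \<le> 1"
    by (metis less_1_mult linorder_not_le order_less_irrefl)
  with key[of a b] key[of b a] ab show thesis by (auto simp: ac_simps)
qed

text \<open>A Bernstein--Walsh inequality: \<open>w\<^sup>n P((w + 1/w)/2)\<close> is a polynomial in \<open>w\<close> and is bounded by \<open>B\<close> on
  the unit circle, hence on the unit disc.\<close>
lemma norm_polynomial_le_off_interval:
  fixes c :: "nat \<Rightarrow> real"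
  assumes B: "\<And>x. \<bar>x\<bar> \<le> 1 \<Longrightarrow> \<bar>\<Sum>i\<le>n. c i * x ^ i\<bar> \<le> B"
  shows "norm (\<Sum>i\<le>n. of_real (c i) * z ^ i :: complex) \<le> B * (1 + 2 * norm z) ^ n"
proof -
  define Q where "Q w = (\<Sum>i\<le>n. of_real (c i) * ((w\<^sup>2 + 1) / 2) ^ i * w ^ (n - i))" for w :: complex
  have Q: "Q w = w ^ n * (\<Sum>i\<le>n. of_real (c i) * ((w + 1 / w) / 2) ^ i)" if "w \<noteq> 0" for w
  proof -
    have "((w\<^sup>2 + 1) / 2) ^ i * w ^ (n - i) = w ^ n * ((w + 1 / w) / 2) ^ i" if "i \<le> n" for i
    proof -
      have "(w\<^sup>2 + 1) / 2 = w * ((w + 1 / w) / 2)"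
        using \<open>w \<noteq> 0\<close> by (simp add: field_simps power2_eq_square)
      then have "((w\<^sup>2 + 1) / 2) ^ i = w ^ i * ((w + 1 / w) / 2) ^ i"
        by (metis power_mult_distrib)
      then have "((w\<^sup>2 + 1) / 2) ^ i * w ^ (n - i) = (w ^ i * w ^ (n - i)) * ((w + 1 / w) / 2) ^ i"
        by (simp only: mult.assoc mult.commute mult.left_commute)
      then show ?thesis using that by (simp flip: power_add)
    qed
    then show ?thesis unfolding Q_def sum_distrib_left
      by (intro sum.cong) (auto simp: mult.assoc mult.left_commute)
  qed
  have Q_circle: "norm (Q w) \<le> B" if "norm w = 1" for w
  proof -
    have "w \<noteq> 0" using that by auto
    have "1 / w = cnj w" using that
      by (metis \<open>w \<noteq> 0\<close> complex_norm_square mult.commute nonzero_divide_eq_eq of_real_1 one_power2)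
    then have re: "(w + 1 / w) / 2 = of_real (Re w)" by (simp add: complex_add_cnj)
    have "norm (Q w) = norm (\<Sum>i\<le>n. of_real (c i * Re w ^ i) :: complex)"
      unfolding Q[OF \<open>w \<noteq> 0\<close>] re by (simp add: norm_mult norm_power that)
    also have "\<dots> = \<bar>\<Sum>i\<le>n. c i * Re w ^ i\<bar>" by (metis norm_of_real of_real_sum)
    also have "\<dots> \<le> B" using abs_Re_le_cmod[of w] that by (intro B) simp
    finally show ?thesis .
  qed
  have Q_disc: "norm (Q w) \<le> B" if "norm w \<le> 1" for w
  proof (rule maximum_modulus_frontier[where f = Q and S = "cball 0 1"])
    show "Q holomorphic_on interior (cball 0 1)" unfolding Q_def by (intro holomorphic_intros) auto
    show "continuous_on (closure (cball 0 1)) Q" unfolding Q_def by (intro continuous_intros) simp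
  qed (use that Q_circle in auto)
  obtain w where w: "w \<noteq> 0" "norm w \<le> 1" "z = (w + 1 / w) / 2" "1 / norm w \<le> 1 + 2 * norm z"
    by (rule joukowski_preimage)
  have "norm (\<Sum>i\<le>n. of_real (c i) * z ^ i) = norm (Q w) * (1 / norm w) ^ n"
    using w(1) unfolding Q[OF w(1)] w(3)[symmetric] by (simp add: norm_mult norm_power power_divide)
  also have "\<dots> \<le> B * (1 + 2 * norm z) ^ n"
    using Q_disc[OF w(2)] w(4) by (intro mult_mono power_mono) (auto intro: order_trans[OF norm_ge_zero])
  finally show ?thesis .
qed

lemma higher_deriv_sum_powers_at_0:
  fixes c :: "nat \<Rightarrow> complex"
  assumes "j \<le> n"
  shows "(deriv ^^ j) (\<lambda>z. \<Sum>i\<le>n. c i * z ^ i) 0 = fact j * c j"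
proof -
  define p where "p = (\<Sum>i\<le>n. monom (c i) i)"
  have p: "(\<lambda>z. \<Sum>i\<le>n. c i * z ^ i) = poly p" by (auto simp: p_def poly_sum poly_monom)
  have "(deriv ^^ i) (poly p) = poly ((pderiv ^^ i) p)" for i
    by (induction i) (auto intro!: DERIV_imp_deriv poly_DERIV)
  then have "(deriv ^^ j) (poly p) 0 = coeff ((pderiv ^^ j) p) 0" by (simp add: poly_0_coeff_0)
  also have "\<dots> = fact j * coeff p j" by (simp add: coeff_higher_pderiv pochhammer_fact)
  also have "coeff p j = c j" using assms by (simp add: p_def coeff_sum sum.delta)
  finally show ?thesis unfolding p .
qed

text \<open>Cauchy's estimate on the circle of radius \<open>j / n\<close> (for \<open>r = 1\<close>) loses only a factor exponential in \<open>j\<close>,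
  whereas iterating Bernstein's inequality for the first derivative would not.\<close>
lemma fact_mult_coeff_le:
  fixes c :: "nat \<Rightarrow> real"
  assumes B: "\<And>x. \<bar>x\<bar> \<le> r \<Longrightarrow> \<bar>\<Sum>i\<le>n. c i * x ^ i\<bar> \<le> B" and "r > 0" "j \<le> n"
  shows "fact j * \<bar>c j\<bar> \<le> B * (exp 2 * real n / r) ^ j"
proof (cases "j = 0")
  case True
  then show ?thesis using B[of 0] \<open>r > 0\<close> by (simp add: sum.atMost_shift)
next
  case False
  \<comment> \<open>This radius balances two effects: the growth factor
    \<open>(1 + 2 * R) ^ n\<close> stays below \<open>exp (2 * j)\<close>, and
    \<open>fact j / R ^ j\<close> is at most \<open>n ^ j\<close> because
    \<open>fact j <= j ^ j\<close>.\<close>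
  define R where "R = real j / real n"
  have "R > 0" using False \<open>j \<le> n\<close> by (simp add: R_def)
  define P where "P z = (\<Sum>i\<le>n. of_real (c i * r ^ i) * z ^ i)" for z :: complex
  have "B \<ge> 0" using B[of 0] \<open>r > 0\<close> by simp
  have le: "norm (P z) \<le> B * exp 2 ^ j" if "norm z = R" for z
  proof -
    have "norm (P z) \<le> B * (1 + 2 * norm z) ^ n" unfolding P_def
    proof (rule norm_polynomial_le_off_interval)
      fix x :: real assume "\<bar>x\<bar> \<le> 1"
      then have "\<bar>r * x\<bar> \<le> r" using \<open>r > 0\<close> by (simp add: abs_mult mult_left_le)
      from B[OF this] show "\<bar>\<Sum>i\<le>n. c i * r ^ i * x ^ i\<bar> \<le> B" by (simp add: power_mult_distrib mult.assoc)
    qed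
    also have "(1 + 2 * norm z) ^ n \<le> exp (2 * R) ^ n"
      using that by (intro power_mono exp_ge_add_one_self) auto
    also have "exp (2 * R) ^ n = exp (2 * real j)"
      using False \<open>j \<le> n\<close> by (simp add: R_def field_simps flip: exp_of_nat_mult)
    also have "\<dots> = exp 2 ^ j" by (simp add: mult.commute flip: exp_of_nat_mult)
    finally show ?thesis using \<open>B \<ge> 0\<close> by (simp add: mult_left_mono)
  qed
  have "norm ((deriv ^^ j) P 0) \<le> fact j * (B * exp 2 ^ j) / R ^ j"
  proof (rule Cauchy_inequality)
    show "P holomorphic_on ball 0 R" unfolding P_def by (intro holomorphic_intros)
    show "continuous_on (cball 0 R) P" unfolding P_def by (intro continuous_intros)
  qed (use \<open>R > 0\<close> le in auto)
  also have "(deriv ^^ j) P 0 = fact j * of_real (c j * r ^ j)"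
    unfolding P_def by (rule higher_deriv_sum_powers_at_0[OF \<open>j \<le> n\<close>])
  finally have "fact j * \<bar>c j\<bar> * r ^ j \<le> fact j * (B * exp 2 ^ j) / R ^ j"
    using \<open>r > 0\<close> by (simp add: norm_mult norm_power abs_mult mult.assoc)
  also have "\<dots> \<le> real j ^ j * (B * exp 2 ^ j) / R ^ j"
    using \<open>B \<ge> 0\<close> \<open>R > 0\<close> fact_le_power[of j, where 'a = real]
    by (intro divide_right_mono mult_right_mono mult_nonneg_nonneg zero_le_power) simp_all
  also have "\<dots> = B * (exp 2 * real n) ^ j"
    using False \<open>j \<le> n\<close> by (simp add: R_def power_divide power_mult_distrib)
  finally show ?thesis using \<open>r > 0\<close> by (simp add: power_divide pos_le_divide_eq)
qed

text \<open>One term of the exponential series is at most its sum. This crude Stirling bound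
  controls the Taylor remainder below and later bounds the slope \<open>t\<close> from
  below.\<close>

lemma power_le_exp_mult_fact: "real n ^ n \<le> exp 1 ^ n * fact n"
proof -
  have "real n ^ n / fact n = (\<Sum>i\<in>{n}. real n ^ i /\<^sub>R fact i)" by (simp add: field_simps)
  also have "\<dots> \<le> (\<Sum>i. real n ^ i /\<^sub>R fact i)"
    by (intro sum_le_suminf summable_exp_generic) auto
  also have "\<dots> = exp (real n)" by (simp add: exp_def)
  also have "\<dots> = exp 1 ^ n" by (simp flip: exp_of_nat_mult)
  finally show ?thesis by (simp add: field_simps)
qed

text \<open>The Taylor polynomial of degree \<open>n - 1\<close> is bounded by \<open>2 * A\<close> on an interval of length comparable to
  \<open>n / s\<close>, so its coefficients are controlled by the previous lemma.\<close>
lemma derivative_interpolation: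
  fixes D :: "nat \<Rightarrow> real \<Rightarrow> real"
  assumes deriv: "\<And>i t. i < n \<Longrightarrow> \<bar>t\<bar> \<le> d \<Longrightarrow> (D i has_real_derivative D (Suc i) t) (at t)"
    and D0: "\<And>t. \<bar>t\<bar> \<le> d \<Longrightarrow> \<bar>D 0 t\<bar> \<le> A"
    and Dn: "\<And>t. \<bar>t\<bar> \<le> d \<Longrightarrow> \<bar>D n t\<bar> \<le> A * s ^ n"
    and "s > 0" "d > 0" "real n \<le> s * d" "j \<le> n"
  shows "\<bar>D j 0\<bar> \<le> 2 * A * (exp 3 * s) ^ j"
proof -
  have "A \<ge> 0" using D0[of 0] \<open>d > 0\<close> by simp
  show ?thesis
  proof (cases "j = n")
    case True
    have "\<bar>D n 0\<bar> \<le> A * s ^ n" using Dn[of 0] \<open>d > 0\<close> by simp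
    also have "\<dots> \<le> (2 * A) * (exp 3 * s) ^ n"
      using \<open>A \<ge> 0\<close> \<open>s > 0\<close> by (intro mult_mono power_mono) auto
    finally show ?thesis using True by simp
  next
    case False
    then obtain n' where n: "n = Suc n'" and "j \<le> n'" using \<open>j \<le> n\<close> by (cases n) auto
    \<comment> \<open>The divisor \<open>exp 1\<close> gives
      \<open>(s * r) ^ n = (n / exp 1) ^ n <= fact n\<close>, so the Lagrange remainder is at most
      \<open>A\<close>. Together with the \<open>exp 2\<close> of the coefficient estimate it
      produces the constant \<open>exp 3\<close>.\<close>
    define r where "r = real n / (exp 1 * s)"
    have "r > 0" using n \<open>s > 0\<close> by (simp add: r_def)
    have "r \<le> real n / s" using \<open>s > 0\<close> unfolding r_def by (intro divide_left_mono) auto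
    also have "\<dots> \<le> d" using \<open>s > 0\<close> \<open>real n \<le> s * d\<close> by (simp add: field_simps)
    finally have "r \<le> d" .
    have P: "\<bar>\<Sum>i\<le>n'. D i 0 / fact i * x ^ i\<bar> \<le> 2 * A" if "\<bar>x\<bar> \<le> r" for x
    proof -
      have "\<forall>m t. m < n \<and> \<bar>t\<bar> \<le> \<bar>x\<bar> \<longrightarrow> (D m has_real_derivative D (Suc m) t) (at t)"
        using deriv that \<open>r \<le> d\<close> by auto
      from Maclaurin_bi_le[OF refl this] obtain t where t: "\<bar>t\<bar> \<le> \<bar>x\<bar>"
        "D 0 x = (\<Sum>m<n. D m 0 / fact m * x ^ m) + D n t / fact n * x ^ n"
        by blast
      have "\<bar>D n t / fact n * x ^ n\<bar> = \<bar>D n t\<bar> * \<bar>x\<bar> ^ n / fact n" by (simp add: abs_mult power_abs)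
      also have "\<dots> \<le> A * s ^ n * r ^ n / fact n"
        using that t(1) \<open>r \<le> d\<close> Dn[of t] \<open>A \<ge> 0\<close> \<open>s > 0\<close>
        by (intro divide_right_mono mult_mono power_mono) auto
      also have "\<dots> = A * (real n ^ n / (exp 1 ^ n * fact n))"
        using \<open>s > 0\<close> by (simp add: r_def power_mult_distrib power_divide)
      also have "\<dots> \<le> A * 1"
        using \<open>A \<ge> 0\<close> power_le_exp_mult_fact[of n] by (intro mult_left_mono) (auto simp: divide_le_eq_1)
      finally have "\<bar>D n t / fact n * x ^ n\<bar> \<le> A" by simp
      moreover have "\<bar>D 0 x\<bar> \<le> A" using D0 that \<open>r \<le> d\<close> by auto
      ultimately have "\<bar>\<Sum>m<n. D m 0 / fact m * x ^ m\<bar> \<le> 2 * A" using t(2) by linarith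
      then show ?thesis by (simp only: n lessThan_Suc_atMost)
    qed
    have "\<bar>D j 0\<bar> = fact j * \<bar>D j 0 / fact j\<bar>" by simp
    also have "\<dots> \<le> 2 * A * (exp 2 * real n' / r) ^ j"
      by (rule fact_mult_coeff_le[OF P \<open>r > 0\<close> \<open>j \<le> n'\<close>])
    also have "\<dots> \<le> 2 * A * (exp 3 * s) ^ j"
    proof -
      have "exp 2 * real n' / r \<le> exp 2 * real n / r" using \<open>r > 0\<close> n by (intro divide_right_mono) auto
      also have "\<dots> = (exp 2 * exp 1) * s" using n by (simp add: r_def)
      also have "\<dots> = exp 3 * s" by (simp flip: exp_add)
      finally show ?thesis using \<open>A \<ge> 0\<close> \<open>r > 0\<close> by (intro mult_left_mono power_mono) auto
    qed
    finally show ?thesis .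
  qed
qed

section \<open>Iterated directional derivatives\<close>

lemma iter_deriv_append: "iter_deriv f (us @ vs) = iter_deriv (iter_deriv f vs) us"
  by (induction us) auto

lemma smooth_on_iter_deriv: "smooth_on U f \<Longrightarrow> smooth_on U (iter_deriv f vs)"
  by (simp add: smooth_on_def flip: iter_deriv_append)

lemma iter_deriv_has_derivative:
  assumes "smooth_on U f" "x \<in> U"
  shows "(iter_deriv f vs has_derivative (\<lambda>v. iter_deriv f (v # vs) x)) (at x)"
  using assms frechet_derivative_works[of "iter_deriv f vs" "at x"] unfolding smooth_on_def by auto

lemma continuous_on_iter_deriv:
  assumes "smooth_on U f" "S \<subseteq> U"
  shows "continuous_on S (iter_deriv f vs)"
  using assms unfolding smooth_on_def
  by (intro differentiable_imp_continuous_on) (auto simp: differentiable_on_def intro: differentiable_at_withinI)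

lemma iter_deriv_cong_open:
  assumes "open U" "\<And>y. y \<in> U \<Longrightarrow> f y = g y" "x \<in> U"
  shows "iter_deriv f vs x = iter_deriv g vs x"
  using assms(3)
proof (induction vs arbitrary: x)
  case (Cons v vs)
  \<comment> \<open>\<open>frechet_derivative\<close> chooses from the set of all derivatives at the
    point, and functions agreeing near \<open>x\<close> have the same set there, even if it is
    empty.\<close>
  have "frechet_derivative (iter_deriv f vs) (at x) = frechet_derivative (iter_deriv g vs) (at x)"
    unfolding frechet_derivative_def
    using has_derivative_transform_within_open[OF _ \<open>open U\<close> Cons.prems] Cons.IH by metis
  then show ?case by simp
qed (use assms in auto)

lemma iter_deriv_line_has_real_derivative:
  fixes x v :: "'a :: real_normed_vector"
  assumes "smooth_on U f" "x + t *\<^sub>R v \<in> U"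
  shows "((\<lambda>t. iter_deriv f vs (x + t *\<^sub>R v)) has_real_derivative iter_deriv f (v # vs) (x + t *\<^sub>R v)) (at t)"
proof -
  let ?L = "\<lambda>w. iter_deriv f (w # vs) (x + t *\<^sub>R v)"
  have D: "(iter_deriv f vs has_derivative ?L) (at (x + t *\<^sub>R v))"
    using assms by (rule iter_deriv_has_derivative)
  have "((\<lambda>t. x + t *\<^sub>R v) has_derivative (\<lambda>h. h *\<^sub>R v)) (at t)"
    by (auto intro!: derivative_eq_intros)
  from has_derivative_compose[OF this D]
  have "((\<lambda>t. iter_deriv f vs (x + t *\<^sub>R v)) has_derivative (\<lambda>h. ?L (h *\<^sub>R v))) (at t)" .
  moreover have "?L (h *\<^sub>R v) = ?L v * h" for h
    using linear_scale[OF has_derivative_linear[OF D]] by simp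
  ultimately show ?thesis by (simp add: has_field_derivative_def)
qed

text \<open>The mean value theorem is applied twice: to \<open>\<psi>\<close> in the direction
  \<open>u\<close>, then to the derivative along \<open>u\<close> in the direction
  \<open>v\<close>.\<close>

lemma second_difference_eq_mixed_derivative:
  fixes x u v :: "'a :: real_normed_vector"
  assumes sm: "smooth_on U h" and sub: "ball x e \<subseteq> U" and "r > 0" and r: "r * (norm u + norm v) < e"
  obtains y where "norm (y - x) \<le> r * (norm u + norm v)"
    "h (x + r *\<^sub>R u + r *\<^sub>R v) - h (x + r *\<^sub>R u) - h (x + r *\<^sub>R v) + h x = r\<^sup>2 * iter_deriv h [v, u] y"
proof -
  have bound: "norm (s *\<^sub>R u + t *\<^sub>R v) \<le> r * (norm u + norm v)" if "0 \<le> s" "s \<le> r" "0 \<le> t" "t \<le> r" for s t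
  proof -
    have "norm (s *\<^sub>R u + t *\<^sub>R v) \<le> s * norm u + t * norm v"
      using that norm_triangle_ineq[of "s *\<^sub>R u" "t *\<^sub>R v"] by simp
    also have "\<dots> \<le> r * norm u + r * norm v" using that by (intro add_mono mult_right_mono) auto
    finally show ?thesis by (simp add: distrib_left)
  qed
  have U: "x + s *\<^sub>R u + t *\<^sub>R v \<in> U" if "0 \<le> s" "s \<le> r" "0 \<le> t" "t \<le> r" for s t
  proof -
    have "dist (x + s *\<^sub>R u + t *\<^sub>R v) x < e"
      using bound[OF that] r by (simp add: dist_norm add.assoc)
    then show ?thesis using sub by (auto simp: dist_commute)
  qed
  define \<psi> where "\<psi> s = h (x + s *\<^sub>R u + r *\<^sub>R v) - h (x + s *\<^sub>R u)" for s
  have \<psi>': "(\<psi> has_real_derivative (iter_deriv h [u] (x + s *\<^sub>R u + r *\<^sub>R v) - iter_deriv h [u] (x + s *\<^sub>R u))) (at s)"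
    if "0 \<le> s" "s \<le> r" for s
  proof -
    have "((\<lambda>s. h (x + r *\<^sub>R v + s *\<^sub>R u)) has_real_derivative iter_deriv h [u] (x + r *\<^sub>R v + s *\<^sub>R u)) (at s)"
      using iter_deriv_line_has_real_derivative[OF sm, of "x + r *\<^sub>R v" s u "[]"] U[of s r] that \<open>r > 0\<close>
      by (simp add: ac_simps)
    moreover have "((\<lambda>s. h (x + s *\<^sub>R u)) has_real_derivative iter_deriv h [u] (x + s *\<^sub>R u)) (at s)"
      using iter_deriv_line_has_real_derivative[OF sm, of x s u "[]"] U[of s 0] that \<open>r > 0\<close> by simp
    ultimately show ?thesis unfolding \<psi>_def
      by (intro DERIV_diff) (simp_all add: ac_simps)
  qed
  obtain s where s: "0 < s" "s < r"
    "\<psi> r - \<psi> 0 = (r - 0) * (iter_deriv h [u] (x + s *\<^sub>R u + r *\<^sub>R v) - iter_deriv h [u] (x + s *\<^sub>R u))"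
    using MVT2[OF \<open>r > 0\<close> \<psi>'] by blast
  have \<phi>': "((\<lambda>t. iter_deriv h [u] (x + s *\<^sub>R u + t *\<^sub>R v)) has_real_derivative
      iter_deriv h [v, u] (x + s *\<^sub>R u + t *\<^sub>R v)) (at t)" if "0 \<le> t" "t \<le> r" for t
    by (rule iter_deriv_line_has_real_derivative[OF sm U]) (use that s in auto)
  obtain t where t: "0 < t" "t < r"
    "iter_deriv h [u] (x + s *\<^sub>R u + r *\<^sub>R v) - iter_deriv h [u] (x + s *\<^sub>R u + 0 *\<^sub>R v)
      = (r - 0) * iter_deriv h [v, u] (x + s *\<^sub>R u + t *\<^sub>R v)"
    using MVT2[OF \<open>r > 0\<close> \<phi>'] by blast
  show thesis
  proof (rule that)
    show "norm (x + s *\<^sub>R u + t *\<^sub>R v - x) \<le> r * (norm u + norm v)"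
      using bound[of s t] s t by (simp add: add.assoc)
    have "\<psi> r - \<psi> 0 = r * (r * iter_deriv h [v, u] (x + s *\<^sub>R u + t *\<^sub>R v))"
      using s(3) t(3) by simp
    then show "h (x + r *\<^sub>R u + r *\<^sub>R v) - h (x + r *\<^sub>R u) - h (x + r *\<^sub>R v) + h x
      = r\<^sup>2 * iter_deriv h [v, u] (x + s *\<^sub>R u + t *\<^sub>R v)"
      unfolding \<psi>_def power2_eq_square mult.assoc by (simp del: iter_deriv.simps)
  qed
qed

text \<open>Schwarz's theorem. The second difference is symmetric in \<open>u\<close> and
  \<open>v\<close>, so the two mixed derivatives take a common value at points arbitrarily close to
  \<open>x\<close>; both are continuous there.\<close>

lemma iter_deriv_swap2:
  assumes sm: "smooth_on U h" and "open U" "x \<in> U"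
  shows "iter_deriv h [u, v] x = iter_deriv h [v, u] x"
proof (rule ccontr)
  let ?F = "iter_deriv h [u, v]" and ?G = "iter_deriv h [v, u]"
  assume "?F x \<noteq> ?G x"
  define \<epsilon> where "\<epsilon> = \<bar>?F x - ?G x\<bar> / 2"
  have "\<epsilon> > 0" using \<open>?F x \<noteq> ?G x\<close> by (simp add: \<epsilon>_def del: iter_deriv.simps)
  obtain e where e: "e > 0" "ball x e \<subseteq> U" using assms by (meson openE)
  have cont: "isCont (iter_deriv h ws) x" for ws
    using sm \<open>x \<in> U\<close> by (auto simp: smooth_on_def intro: differentiable_imp_continuous_within)
  obtain d1 where d1: "d1 > 0" "\<And>y. dist y x < d1 \<Longrightarrow> dist (?F y) (?F x) < \<epsilon>"
    using cont[of "[u, v]"] \<open>\<epsilon> > 0\<close> unfolding continuous_at_eps_delta by (metis dist_commute)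
  obtain d2 where d2: "d2 > 0" "\<And>y. dist y x < d2 \<Longrightarrow> dist (?G y) (?G x) < \<epsilon>"
    using cont[of "[v, u]"] \<open>\<epsilon> > 0\<close> unfolding continuous_at_eps_delta by (metis dist_commute)
  define d where "d = min e (min d1 d2)"
  have "d > 0" using e d1 d2 by (simp add: d_def)
  \<comment> \<open>The summand 1 keeps the denominator positive when \<open>u\<close> and
    \<open>v\<close> vanish and makes the estimate \<open>rd\<close> strict.\<close>
  define r where "r = d / (norm u + norm v + 1)"
  have "r > 0" using \<open>d > 0\<close> by (simp add: r_def add_nonneg_pos)
  have rd: "r * (norm u + norm v) < d"
  proof -
    have "r * (norm u + norm v) < r * (norm u + norm v + 1)" using \<open>r > 0\<close> by simp
    also have "\<dots> = d" unfolding r_def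
      by (simp add: add_nonneg_pos less_imp_neq[THEN not_sym])
    finally show ?thesis .
  qed
  then have re: "r * (norm u + norm v) < e" "r * (norm v + norm u) < e" by (auto simp: d_def ac_simps)
  obtain y where y: "norm (y - x) \<le> r * (norm u + norm v)"
    "h (x + r *\<^sub>R u + r *\<^sub>R v) - h (x + r *\<^sub>R u) - h (x + r *\<^sub>R v) + h x = r\<^sup>2 * ?G y"
    by (rule second_difference_eq_mixed_derivative[OF sm e(2) \<open>r > 0\<close> re(1)])
  obtain z where z: "norm (z - x) \<le> r * (norm v + norm u)"
    "h (x + r *\<^sub>R v + r *\<^sub>R u) - h (x + r *\<^sub>R v) - h (x + r *\<^sub>R u) + h x = r\<^sup>2 * ?F z"
    by (rule second_difference_eq_mixed_derivative[OF sm e(2) \<open>r > 0\<close> re(2)])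
  have swap: "x + r *\<^sub>R v + r *\<^sub>R u = x + r *\<^sub>R u + r *\<^sub>R v" by simp
  have "r\<^sup>2 * ?G y = r\<^sup>2 * ?F z" using y(2) z(2) unfolding swap by linarith
  then have "?G y = ?F z" using \<open>r > 0\<close> by (simp del: iter_deriv.simps)
  moreover have "dist (?G y) (?G x) < \<epsilon>" using y(1) rd by (intro d2) (auto simp: dist_norm d_def)
  moreover have "dist (?F z) (?F x) < \<epsilon>" using z(1) rd by (intro d1) (auto simp: dist_norm d_def ac_simps)
  ultimately show False unfolding \<epsilon>_def dist_real_def by argo
qed

lemma iter_deriv_move:
  assumes "smooth_on U f" "open U" "x \<in> U"
  shows "iter_deriv f (v # vs @ us) x = iter_deriv f (vs @ v # us) x"
  using assms(3)
proof (induction vs arbitrary: x)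
  case (Cons w vs)
  have "iter_deriv f (v # (w # vs) @ us) x = iter_deriv (iter_deriv f (vs @ us)) [v, w] x" by simp
  also have "\<dots> = iter_deriv (iter_deriv f (vs @ us)) [w, v] x"
    using assms Cons.prems by (intro iter_deriv_swap2 smooth_on_iter_deriv)
  also have "\<dots> = iter_deriv (iter_deriv f (v # vs @ us)) [w] x" by simp
  also have "\<dots> = iter_deriv (iter_deriv f (vs @ v # us)) [w] x"
    using iter_deriv_cong_open[OF \<open>open U\<close> Cons.IH Cons.prems, where vs = "[w]"] .
  also have "\<dots> = iter_deriv f ((w # vs) @ v # us) x" by simp
  finally show ?case .
qed simp

text \<open>This permits collecting equal directions in one block, so that a block can be treated as
  a higher derivative in one variable.\<close>

lemma iter_deriv_mset_cong:
  assumes "smooth_on U f" "open U" "x \<in> U" "mset vs = mset ws"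
  shows "iter_deriv f vs x = iter_deriv f ws x"
  using assms(3,4)
proof (induction vs arbitrary: ws x)
  case (Cons v vs)
  have "v \<in> set ws" using Cons.prems(2) by (metis list.set_intros(1) mset_eq_setD)
  then obtain ws1 ws2 where ws: "ws = ws1 @ v # ws2" by (meson split_list)
  have "mset vs = mset (ws1 @ ws2)" using Cons.prems(2) by (simp add: ws)
  then have "iter_deriv f vs y = iter_deriv f (ws1 @ ws2) y" if "y \<in> U" for y
    using Cons.IH that by blast
  from iter_deriv_cong_open[OF \<open>open U\<close> this Cons.prems(1), where vs = "[v]"]
  have "iter_deriv f (v # vs) x = iter_deriv f (v # ws1 @ ws2) x" by simp
  also have "\<dots> = iter_deriv f ws x"
    unfolding ws by (rule iter_deriv_move[OF assms(1,2) Cons.prems(1)])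
  finally show ?case .
qed simp

text \<open>Multilinear expansion in the basis costs a factor \<open>DIM('a)\<close> per direction,
  a geometric loss that \<open>\<rho>\<close> can absorb. Linearity is immediate only in the head of
  the list, so each basis vector is moved behind the directions still to be expanded.\<close>

lemma abs_iter_deriv_le_Basis:
  fixes f :: "'a::euclidean_space \<Rightarrow> real"
  assumes sm: "smooth_on U f" and "open U" "x \<in> U"
    and B: "\<And>us. set us \<subseteq> Basis \<Longrightarrow> length us = k \<Longrightarrow> \<bar>iter_deriv f us x\<bar> \<le> B"
    and "\<forall>v\<in>set vs. norm v \<le> 1" "length vs = k"
  shows "\<bar>iter_deriv f vs x\<bar> \<le> real DIM('a) ^ k * B"
proof -
  have "\<bar>iter_deriv f (vs @ us) x\<bar> \<le> real DIM('a) ^ length vs * B"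
    if "\<forall>v\<in>set vs. norm v \<le> 1" "set us \<subseteq> Basis" "length vs + length us = k" for vs us
    using that
  proof (induction vs arbitrary: us)
    case Nil
    then show ?case using B[of us] by simp
  next
    case (Cons v vs)
    let ?L = "\<lambda>v. iter_deriv f (v # vs @ us) x"
    have lin: "linear ?L"
      using iter_deriv_has_derivative[OF sm \<open>x \<in> U\<close>] by (rule has_derivative_linear)
    have "?L v = ?L (\<Sum>b\<in>Basis. (v \<bullet> b) *\<^sub>R b)" by (simp only: euclidean_representation)
    also have "\<dots> = (\<Sum>b\<in>Basis. (v \<bullet> b) * ?L b)"
      by (simp only: linear_sum[OF lin] linear_scale[OF lin] real_scaleR_def)
    finally have "\<bar>?L v\<bar> \<le> (\<Sum>b\<in>Basis. \<bar>(v \<bullet> b) * ?L b\<bar>)" by (simp only: sum_abs)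
    also have "\<dots> \<le> (\<Sum>b\<in>(Basis::'a set). real DIM('a) ^ length vs * B)"
    proof (rule sum_mono)
      fix b :: 'a assume b: "b \<in> Basis"
      have "\<bar>v \<bullet> b\<bar> \<le> 1" using Basis_le_norm[OF b, of v] Cons.prems(1) by auto
      then have "\<bar>(v \<bullet> b) * ?L b\<bar> \<le> \<bar>?L b\<bar>" unfolding abs_mult by (intro mult_left_le_one_le) auto
      also have "\<bar>?L b\<bar> = \<bar>iter_deriv f (vs @ b # us) x\<bar>"
        by (simp only: iter_deriv_move[OF assms(1-3)])
      also have "\<dots> \<le> real DIM('a) ^ length vs * B" using b Cons.prems by (intro Cons.IH) auto
      finally show "\<bar>(v \<bullet> b) * ?L b\<bar> \<le> real DIM('a) ^ length vs * B" .
    qed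
    also have "\<dots> = real DIM('a) ^ length (v # vs) * B" by simp
    finally show ?case by (simp only: append_Cons)
  qed
  from this[of vs "[]"] show ?thesis using assms by simp
qed

text \<open>Only finitely many lists of \<open>k\<close> basis vectors exist, and each corresponding
  derivative is continuous on \<open>K\<close>.\<close>

lemma bounded_iter_deriv_compact:
  fixes f :: "'a::euclidean_space \<Rightarrow> real"
  assumes sm: "smooth_on U f" and "open U" "K \<subseteq> U" "compact K"
  obtains B where "B \<ge> 0"
    "\<And>x vs. x \<in> K \<Longrightarrow> \<forall>v\<in>set vs. norm v \<le> 1 \<Longrightarrow> length vs = k \<Longrightarrow> \<bar>iter_deriv f vs x\<bar> \<le> B"
proof -
  let ?S = "{us. set us \<subseteq> (Basis :: 'a set) \<and> length us = k}"
  have fin: "finite ?S" by (intro finite_lists_length_eq) auto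
  have "\<exists>b. \<forall>x\<in>K. \<bar>iter_deriv f us x\<bar> \<le> b" for us
    using compact_continuous_image[OF continuous_on_iter_deriv[OF sm \<open>K \<subseteq> U\<close>] \<open>compact K\<close>, of us]
    by (auto dest!: compact_imp_bounded simp: bounded_iff)
  then obtain b where b: "\<And>us x. x \<in> K \<Longrightarrow> \<bar>iter_deriv f us x\<bar> \<le> b us" by metis
  define B where "B = (\<Sum>us\<in>?S. \<bar>b us\<bar>)"
  have "\<bar>iter_deriv f us x\<bar> \<le> B" if "x \<in> K" "us \<in> ?S" for us x
    using b[OF that(1), of us] member_le_sum[OF that(2) _ fin, of "\<lambda>us. \<bar>b us\<bar>"] unfolding B_def by auto
  then have "\<bar>iter_deriv f vs x\<bar> \<le> real DIM('a) ^ k * B"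
    if "x \<in> K" "\<forall>v\<in>set vs. norm v \<le> 1" "length vs = k" for x vs
    using that \<open>K \<subseteq> U\<close> by (intro abs_iter_deriv_le_Basis[OF sm \<open>open U\<close>]) auto
  moreover have "B \<ge> 0" by (simp add: B_def sum_nonneg)
  ultimately show thesis by (intro that[of "real DIM('a) ^ k * B"]) auto
qed

text \<open>Grouping the directions by basis vectors needs only \<open>DIM\<close> applications of the one-dimensional
  interpolation; one application per derivative would cost a factor like \<open>j\<^sup>j\<close>.\<close>
lemma interpolation_along_directions:
  fixes f :: "'a::euclidean_space \<Rightarrow> real"
  assumes "smooth_on U f" "open U" "cball x (real (length bs) * d) \<subseteq> U"
    and "set bs \<subseteq> Basis" "set ws \<subseteq> set bs" "length ws \<le> n"
    and "s > 0" "d > 0" "real n \<le> s * d"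
    and "\<And>y. y \<in> cball x (real (length bs) * d) \<Longrightarrow> \<bar>f y\<bar> \<le> A"
    and "\<And>y us. y \<in> cball x (real (length bs) * d) \<Longrightarrow> set us \<subseteq> Basis \<Longrightarrow> length us = n \<Longrightarrow>
           \<bar>iter_deriv f us y\<bar> \<le> A * s ^ n"
  shows "\<bar>iter_deriv f ws x\<bar> \<le> 2 ^ length bs * A * (exp 3 * s) ^ length ws"
  using assms(1,3,4-6) \<open>real n \<le> s * d\<close> assms(10,11)
proof (induction bs arbitrary: f ws n A)
  case Nil
  then show ?case by simp
next
  case (Cons b bs)
  note sm = Cons.prems(1) and sub = Cons.prems(2) and f0 = Cons.prems(7) and fn = Cons.prems(8)
  define c where "c = count (mset ws) b"
  define ws' where "ws' = filter (\<lambda>w. w \<noteq> b) ws"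
  have "mset ws = mset ws' + replicate_mset c b"
    by (rule multiset_eqI) (auto simp: c_def ws'_def)
  then have mset_ws: "mset ws = mset (ws' @ replicate c b)" by simp
  then have len_ws: "length ws = length ws' + c"
    by (metis length_append length_replicate mset_eq_length)
  have "b \<in> Basis" using Cons.prems(3) by simp
  define h where "h = iter_deriv f (replicate c b)"
  have smh: "smooth_on U h" using sm unfolding h_def by (rule smooth_on_iter_deriv)
  have A: "A \<ge> 0" using f0[of x] \<open>d > 0\<close> by fastforce
  have subball: "cball x (real (length bs) * d) \<subseteq> cball x (real (length (b # bs)) * d)"
    using \<open>d > 0\<close> by (intro subset_cball) simp
  \<comment> \<open>A segment of half-length \<open>d\<close> along \<open>b\<close> around a point
    of the smaller ball stays in the larger one: each basis vector uses up one \<open>d\<close> of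
    the radius.\<close>
  have h0: "\<bar>h y\<bar> \<le> 2 * A * (exp 3 * s) ^ c" if y: "y \<in> cball x (real (length bs) * d)" for y
  proof -
    have yt: "y + t *\<^sub>R b \<in> cball x (real (length (b # bs)) * d)" if "\<bar>t\<bar> \<le> d" for t
    proof -
      have "dist x (y + t *\<^sub>R b) \<le> dist x y + dist y (y + t *\<^sub>R b)" by (rule dist_triangle)
      also have "dist y (y + t *\<^sub>R b) = \<bar>t\<bar>" using \<open>b \<in> Basis\<close> by (simp add: dist_norm)
      finally show ?thesis using that y by (simp add: algebra_simps)
    qed
    have "\<bar>iter_deriv f (replicate c b) (y + 0 *\<^sub>R b)\<bar> \<le> 2 * A * (exp 3 * s) ^ c"
    proof (rule derivative_interpolation[where D = "\<lambda>i t. iter_deriv f (replicate i b) (y + t *\<^sub>R b)" and n = n])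
      show "((\<lambda>t. iter_deriv f (replicate i b) (y + t *\<^sub>R b)) has_real_derivative
          iter_deriv f (replicate (Suc i) b) (y + t *\<^sub>R b)) (at t)" if "i < n" "\<bar>t\<bar> \<le> d" for i t
        using iter_deriv_line_has_real_derivative[OF sm] yt[OF that(2)] sub
        by (simp only: replicate_Suc) blast
      show "\<bar>iter_deriv f (replicate 0 b) (y + t *\<^sub>R b)\<bar> \<le> A" if "\<bar>t\<bar> \<le> d" for t
        using f0[OF yt[OF that]] by simp
      show "\<bar>iter_deriv f (replicate n b) (y + t *\<^sub>R b)\<bar> \<le> A * s ^ n" if "\<bar>t\<bar> \<le> d" for t
        using \<open>b \<in> Basis\<close> by (intro fn[OF yt[OF that]]) auto
    qed (use \<open>s > 0\<close> \<open>d > 0\<close> Cons.prems(5,6) len_ws in auto)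
    then show ?thesis by (simp add: h_def)
  qed
  \<comment> \<open>The function \<open>h\<close> satisfies the hypotheses again, with
    \<open>n - c\<close> for \<open>n\<close> and \<open>2 * A * (exp 3 * s) ^ c\<close> for
    \<open>A\<close>; the scale \<open>s\<close> is unchanged.\<close>
  have hn: "\<bar>iter_deriv h us y\<bar> \<le> 2 * A * (exp 3 * s) ^ c * s ^ (n - c)"
    if "y \<in> cball x (real (length bs) * d)" "set us \<subseteq> Basis" "length us = n - c" for y us
  proof -
    have "\<bar>iter_deriv f (us @ replicate c b) y\<bar> \<le> A * s ^ n"
      using that subball \<open>b \<in> Basis\<close> Cons.prems(5) len_ws by (intro fn) auto
    also have "\<dots> = A * s ^ c * s ^ (n - c)"
      using Cons.prems(5) len_ws by (simp flip: power_add)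
    also have "\<dots> \<le> 2 * A * (exp 3 * s) ^ c * s ^ (n - c)"
      using A \<open>s > 0\<close> by (intro mult_right_mono mult_mono power_mono) auto
    finally show ?thesis by (simp add: h_def iter_deriv_append)
  qed
  have "x \<in> U" using sub \<open>d > 0\<close> by (meson centre_in_cball mult_nonneg_nonneg of_nat_0_le_iff order_less_imp_le subsetD)
  then have "iter_deriv f ws x = iter_deriv h ws' x"
    using iter_deriv_mset_cong[OF sm \<open>open U\<close> _ mset_ws] by (simp add: h_def iter_deriv_append)
  then have "\<bar>iter_deriv f ws x\<bar> = \<bar>iter_deriv h ws' x\<bar>" by simp
  also have "\<dots> \<le> 2 ^ length bs * (2 * A * (exp 3 * s) ^ c) * (exp 3 * s) ^ length ws'"
  proof (rule Cons.IH[OF smh])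
    show "cball x (real (length bs) * d) \<subseteq> U" using sub subball by blast
    show "set bs \<subseteq> Basis" "set ws' \<subseteq> set bs" using Cons.prems(3,4) by (auto simp: ws'_def)
    show "length ws' \<le> n - c" using Cons.prems(5) len_ws by simp
    show "real (n - c) \<le> s * d" using Cons.prems(6) by simp
  qed (use h0 hn in auto)
  also have "\<dots> = 2 ^ length (b # bs) * A * (exp 3 * s) ^ length ws"
    by (simp add: len_ws power_add)
  finally show ?case .
qed

section \<open>The regularised weight sequence\<close>

text \<open>Geometrically, \<open>ln t\<close> is the slope of the edge of the lower convex hull of the points \<open>(j, ln (m j))\<close>
  that lies over \<open>[k - 1, k]\<close>, and \<open>p\<close>, \<open>q\<close> are abscissae of points on it.\<close>
lemma common_maximizers:
  fixes m :: "nat \<Rightarrow> real"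
  assumes m: "\<And>k. m k > 0" and lim: "\<And>t. (\<lambda>k. t ^ k / m k) \<longlonglongrightarrow> 0" and "k > 0"
  obtains t p q where "t > 0" "p < k" "k \<le> q" "\<And>j. t ^ j / m j \<le> t ^ p / m p" "t ^ q / m q = t ^ p / m p"
proof -
  \<comment> \<open>The logarithm of \<open>sl p q\<close> is the slope of the chord between the
    points \<open>(p, ln (m p))\<close> and \<open>(q, ln (m q))\<close>.\<close>
  define sl where "sl p q = root (q - p) (m q / m p)" for p q
  have sl_pos: "sl p q > 0" if "p < q" for p q using that m by (simp add: sl_def)
  have sl_power: "sl p q ^ (q - p) = m q / m p" if "p < q" for p q
    using that m[of p] m[of q] by (simp add: sl_def)
  have frac: "t ^ q / m q \<le> t ^ p / m p \<longleftrightarrow> t ^ (q - p) \<le> m q / m p" if "p < q" "t > 0" for t p q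
  proof -
    have "t ^ q = t ^ (q - p) * t ^ p" using that by (simp flip: power_add)
    then show ?thesis using that m[of p] m[of q] by (simp add: field_simps)
  qed
  have le_sl: "t \<le> sl p q \<longleftrightarrow> t ^ q / m q \<le> t ^ p / m p" if "p < q" "t > 0" for t p q
    using frac[OF that] sl_power[OF that(1)] sl_pos[OF that(1)] that
      power_mono_iff[of t "sl p q" "q - p"] by simp
  have frac': "t ^ p / m p \<le> t ^ q / m q \<longleftrightarrow> m q / m p \<le> t ^ (q - p)" if "p < q" "t > 0" for t p q
  proof -
    have "t ^ q = t ^ (q - p) * t ^ p" using that by (simp flip: power_add)
    then show ?thesis using that m[of p] m[of q] by (simp add: field_simps)
  qed
  have sl_le: "sl p q \<le> t \<longleftrightarrow> t ^ p / m p \<le> t ^ q / m q" if "p < q" "t > 0" for t p q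
    using frac'[OF that] sl_power[OF that(1)] sl_pos[OF that(1)] that
      power_mono_iff[of "sl p q" t "q - p"] by simp
  \<comment> \<open>The edge crossing \<open>[k - 1, k]\<close> has the min-max slope: for each
    \<open>q >= k\<close> the steepest chord from the left of \<open>k\<close>, then the least of
    these over \<open>q\<close>.\<close>
  define \<phi> where "\<phi> q = Max ((\<lambda>p. sl p q) ` {..<k})" for q
  have ne: "{..<k} \<noteq> {}" using \<open>k > 0\<close> by auto
  have \<phi>_ge: "sl p q \<le> \<phi> q" if "p < k" for p q using that by (auto simp: \<phi>_def)
  have \<phi>_attained: "\<exists>p<k. \<phi> q = sl p q" for q
  proof -
    have "\<phi> q \<in> (\<lambda>p. sl p q) ` {..<k}" unfolding \<phi>_def using ne by (intro Max_in) auto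
    then show ?thesis by auto
  qed
  have \<phi>_pos: "\<phi> q > 0" if "k \<le> q" for q
    using \<phi>_ge[OF \<open>k > 0\<close>, of q] sl_pos[of 0 q] that \<open>k > 0\<close> by simp
  \<comment> \<open>Superexponential growth of \<open>m\<close> makes even the chord from 0 to a
    distant \<open>q\<close> steeper than \<open>\<phi> k\<close>. Hence the minimum over all
    \<open>q >= k\<close> is attained on a finite range.\<close>
  have "eventually (\<lambda>q. \<phi> k ^ q / m q < 1 / m 0) sequentially"
    using order_tendstoD(2)[OF lim[of "\<phi> k"], of "1 / m 0"] m by simp
  then obtain Q where Q: "\<And>q. q \<ge> Q \<Longrightarrow> \<phi> k ^ q / m q < 1 / m 0"
    by (auto simp: eventually_sequentially)
  have \<phi>_large: "\<phi> k \<le> \<phi> q" if "q \<ge> Q" "q \<ge> k" for q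
  proof -
    have "\<phi> k \<le> sl 0 q" using le_sl[of 0 q "\<phi> k"] Q[OF that(1)] that \<open>k > 0\<close> \<phi>_pos[of k] by simp
    then show ?thesis using \<phi>_ge[OF \<open>k > 0\<close>, of q] by simp
  qed
  have "Min (\<phi> ` {k..max k Q}) \<in> \<phi> ` {k..max k Q}" by (intro Min_in) auto
  then obtain q where q: "k \<le> q" "\<phi> q = Min (\<phi> ` {k..max k Q})"
    by (elim imageE) (metis atLeastAtMost_iff)
  have \<phi>_min: "\<phi> q \<le> \<phi> q'" if "k \<le> q'" for q'
  proof (cases "q' \<le> max k Q")
    case True
    then show ?thesis using that by (simp add: q(2))
  next
    case False
    have "\<phi> q \<le> \<phi> k" by (simp add: q(2))
    also have "\<phi> k \<le> \<phi> q'" using False by (intro \<phi>_large) auto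
    finally show ?thesis .
  qed
  define t where "t = \<phi> q"
  have "t > 0" using \<phi>_pos q by (simp add: t_def)
  obtain p where p: "p < k" "t = sl p q" using \<phi>_attained[of q] by (auto simp: t_def)
  have eq: "t ^ q / m q = t ^ p / m p"
    using le_sl[of p q t] sl_le[of p q t] p q \<open>t > 0\<close> by simp
  have low: "t ^ j / m j \<le> t ^ p / m p" if "j < k" for j
    using sl_le[of j q t] \<phi>_ge[OF that, of q] that q \<open>t > 0\<close> eq by (simp add: t_def)
  \<comment> \<open>Indices below \<open>k\<close> are compared with \<open>q\<close> through the
    maximality in \<open>\<phi> q\<close>. An index \<open>j >= k\<close> is compared with the
    starting point \<open>i < k\<close> of its steepest chord, whose slope is at least that of the
    minimal \<open>q\<close>.\<close>
  have "t ^ j / m j \<le> t ^ p / m p" for j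
  proof (cases "j < k")
    case False
    then obtain i where "i < k" "\<phi> j = sl i j" using \<phi>_attained[of j] by auto
    then have "t ^ j / m j \<le> t ^ i / m i"
      using le_sl[of i j t] \<phi>_min[of j] False \<open>t > 0\<close> by (simp add: t_def)
    then show ?thesis using low[OF \<open>i < k\<close>] by simp
  qed (rule low)
  then show thesis using that \<open>t > 0\<close> p q eq by blast
qed

text \<open>The limit, for every real \<open>t\<close>, is equivalent to
  \<open>(k! M_k)^(1/k)\<close> tending to infinity. It makes the suprema \<open>T_M M t\<close>
  finite.\<close>

locale weight_sequence =
  fixes M :: "nat \<Rightarrow> real"
  assumes M_pos: "M k > 0"
    and power_over_M_tendsto_0: "(\<lambda>k. t ^ k / (fact k * M k)) \<longlonglongrightarrow> 0"
begin

lemma T_M_upper: "t ^ k / (fact k * M k) \<le> T_M M t"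
proof -
  have "Bseq (\<lambda>k. t ^ k / (fact k * M k))"
    using power_over_M_tendsto_0 by (intro convergent_imp_Bseq convergentI)
  then have "bdd_above (range (\<lambda>k. t ^ k / (fact k * M k)))" by (rule Bseq_bdd_above)
  then show ?thesis unfolding T_M_def by (intro cSUP_upper) auto
qed

lemma T_M_pos: "T_M M t > 0"
proof -
  have "0 < t ^ 0 / (fact 0 * M 0)" using M_pos[of 0] by simp
  also have "\<dots> \<le> T_M M t" by (rule T_M_upper)
  finally show ?thesis .
qed

lemma power_over_T_M_le: "t > 0 \<Longrightarrow> t ^ k / T_M M t \<le> fact k * M k"
  using T_M_upper[of t k] T_M_pos[of t] M_pos[of k] by (simp add: field_simps)

lemma fact_mult_M_bc: "fact k * M_bc M k = (SUP t \<in> {0<..}. t ^ k / T_M M t)"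
  by (simp add: M_bc_def)

lemma M_bc_upper:
  assumes "t > 0"
  shows "t ^ k / T_M M t \<le> fact k * M_bc M k"
proof -
  have "bdd_above ((\<lambda>t. t ^ k / T_M M t) ` {0<..})"
    by (rule bdd_aboveI2[where M = "fact k * M k"]) (simp add: power_over_T_M_le)
  then show ?thesis unfolding fact_mult_M_bc using assms by (intro cSUP_upper) simp
qed

lemma fact_mult_M_bc_least:
  assumes "\<And>t. t > 0 \<Longrightarrow> t ^ k / T_M M t \<le> B"
  shows "fact k * M_bc M k \<le> B"
  unfolding fact_mult_M_bc using assms by (intro cSUP_least) auto

lemma M_bc_le: "M_bc M k \<le> M k"
  using fact_mult_M_bc_least[of k "fact k * M k"] power_over_T_M_le by simp

lemma M_bc_pos: "M_bc M k > 0"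
proof -
  have "0 < 1 ^ k / T_M M 1" using T_M_pos by simp
  also have "\<dots> \<le> fact k * M_bc M k" by (rule M_bc_upper) simp
  finally show ?thesis by (simp add: zero_less_mult_iff)
qed

text \<open>If \<open>t <= u\<close>, replacing \<open>t ^ i\<close> by \<open>u ^ i\<close> gathers
  all powers at \<open>u\<close> and leaves \<open>1 / T_M M t\<close>, which is at most
  \<open>M_bc M 0\<close>. That factor appears because \<open>M 0\<close> is not normalised to
  1.\<close>

lemma M_bc_supermultiplicative:
  "(fact i * M_bc M i) * (fact j * M_bc M j) \<le> M_bc M 0 * (fact (i + j) * M_bc M (i + j))" (is "_ \<le> ?R")
proof -
  have prod: "(t ^ i / T_M M t) * (u ^ j / T_M M u) \<le> ?R" if "t > 0" "u > 0" for t u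
  proof -
    have *: "(t ^ i / T_M M t) * (u ^ j / T_M M u) \<le> M_bc M 0 * (fact (i + j) * M_bc M (i + j))" if "t \<le> u" "t > 0" for t u i j
    proof -
      have "(t ^ i / T_M M t) * (u ^ j / T_M M u) \<le> (u ^ i / T_M M t) * (u ^ j / T_M M u)"
        using that T_M_pos[of t] T_M_pos[of u] by (intro mult_right_mono divide_right_mono power_mono) auto
      also have "\<dots> = (t ^ 0 / T_M M t) * (u ^ (i + j) / T_M M u)" by (simp add: power_add)
      also have "\<dots> \<le> (fact 0 * M_bc M 0) * (fact (i + j) * M_bc M (i + j))"
        using that T_M_pos[of u] M_bc_pos[of 0] by (intro mult_mono M_bc_upper) auto
      finally show ?thesis by simp
    qed
    show ?thesis
      using *[of t u i j] *[of u t j i] that by (cases "t \<le> u") (auto simp: mult.commute add.commute)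
  qed
  have "(t ^ i / T_M M t) * (fact j * M_bc M j) \<le> ?R" if "t > 0" for t
  proof -
    have pos: "t ^ i / T_M M t > 0" using that T_M_pos[of t] by simp
    have "fact j * M_bc M j \<le> ?R / (t ^ i / T_M M t)"
    proof (rule fact_mult_M_bc_least)
      fix u :: real assume "u > 0"
      from prod[OF that this] show "u ^ j / T_M M u \<le> ?R / (t ^ i / T_M M t)"
        by (subst pos_le_divide_eq[OF pos]) (simp only: mult.commute)
    qed
    then show ?thesis unfolding pos_le_divide_eq[OF pos] by (simp only: mult.commute)
  qed
  then have "fact i * M_bc M i \<le> ?R / (fact j * M_bc M j)"
    using M_bc_pos[of j] by (intro fact_mult_M_bc_least) (simp add: pos_le_divide_eq)
  then show ?thesis using M_bc_pos[of j] by (simp add: pos_le_divide_eq)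
qed

text \<open>At the slope \<open>t\<close> of the common maximizers, \<open>T_M M t\<close> equals
  \<open>t ^ p / (fact p * M p)\<close>, and this single \<open>t\<close> bounds the supremum
  defining \<open>M_bc M k\<close> from below. Comparing the maximum with index 0 gives the last
  claim, from which \<open>t\<close> will be bounded below.\<close>

lemma M_bc_ge_interpolated:
  assumes "k > 0"
  obtains t p q where "t > 0" "p < k" "k \<le> q"
    "fact q * M q = t ^ (q - p) * (fact p * M p)"
    "t ^ (k - p) * (fact p * M p) \<le> fact k * M_bc M k"
    "fact q * M q \<le> t ^ q * M 0"
proof -
  obtain t p q where t: "t > 0" "p < k" "k \<le> q"
    and max: "\<And>j. t ^ j / (fact j * M j) \<le> t ^ p / (fact p * M p)"
    and eq: "t ^ q / (fact q * M q) = t ^ p / (fact p * M p)"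
    using common_maximizers[of "\<lambda>k. fact k * M k" k] M_pos power_over_M_tendsto_0 assms by auto
  have "T_M M t \<le> t ^ p / (fact p * M p)" unfolding T_M_def by (intro cSUP_least) (auto simp: max)
  then have T: "T_M M t = t ^ p / (fact p * M p)" using T_M_upper[of t p] by simp
  show thesis
  proof
    have "t ^ q = t ^ (q - p) * t ^ p" using t by (simp flip: power_add)
    then show "fact q * M q = t ^ (q - p) * (fact p * M p)"
      using eq t(1) M_pos[of p] M_pos[of q] by (simp add: field_simps)
    have "t ^ k = t ^ (k - p) * t ^ p" using t by (simp flip: power_add)
    then have "t ^ (k - p) * (fact p * M p) = t ^ k / T_M M t"
      using t(1) M_pos[of p] by (simp add: T)
    also have "\<dots> \<le> fact k * M_bc M k" using t(1) by (rule M_bc_upper)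
    finally show "t ^ (k - p) * (fact p * M p) \<le> fact k * M_bc M k" .
    show "fact q * M q \<le> t ^ q * M 0"
      using max[of 0] unfolding eq[symmetric] using M_pos[of 0] M_pos[of q] by (simp add: field_simps)
  qed (use t in auto)
qed

end

section \<open>Sums and products of smooth functions\<close>

text \<open>A guessed family \<open>G\<close> that is closed under differentiation yields smoothness
  and the formula at once; sums, multiples and products are all handled this way.\<close>

lemma iter_deriv_eqI:
  assumes "open U" and G0: "\<And>x. x \<in> U \<Longrightarrow> F x = G [] x"
    and G: "\<And>vs x. x \<in> U \<Longrightarrow> (G vs has_derivative (\<lambda>v. G (v # vs) x)) (at x)"
  shows "smooth_on U F" and "x \<in> U \<Longrightarrow> iter_deriv F vs x = G vs x"
proof -
  have step: "(iter_deriv F vs has_derivative (\<lambda>v. G (v # vs) x)) (at x)"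
    if "\<And>y. y \<in> U \<Longrightarrow> iter_deriv F vs y = G vs y" "x \<in> U" for vs x
    using has_derivative_transform_within_open[OF G[OF \<open>x \<in> U\<close>] \<open>open U\<close> \<open>x \<in> U\<close>] that(1) by simp
  have eq: "iter_deriv F vs x = G vs x" if "x \<in> U" for vs x
    using that
  proof (induction vs arbitrary: x)
    case (Cons v vs)
    show ?case using frechet_derivative_at[OF step[OF Cons.IH Cons.prems], symmetric] by simp
  qed (simp add: G0)
  then show "x \<in> U \<Longrightarrow> iter_deriv F vs x = G vs x" .
  show "smooth_on U F" unfolding smooth_on_def differentiable_def using step eq by blast
qed

lemma iter_deriv_add:
  assumes "open U" "smooth_on U f" "smooth_on U g"
  shows "smooth_on U (\<lambda>x. f x + g x)"
    and "x \<in> U \<Longrightarrow> iter_deriv (\<lambda>x. f x + g x) vs x = iter_deriv f vs x + iter_deriv g vs x"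
  by (rule iter_deriv_eqI[OF \<open>open U\<close>, where G = "\<lambda>vs x. iter_deriv f vs x + iter_deriv g vs x"];
      use assms in \<open>auto simp del: iter_deriv.simps(2) intro: has_derivative_add iter_deriv_has_derivative\<close>)+

lemma iter_deriv_cmult:
  assumes "open U" "smooth_on U f"
  shows "smooth_on U (\<lambda>x. c * f x)"
    and "x \<in> U \<Longrightarrow> iter_deriv (\<lambda>x. c * f x) vs x = c * iter_deriv f vs x"
  by (rule iter_deriv_eqI[OF \<open>open U\<close>, where G = "\<lambda>vs x. c * iter_deriv f vs x"];
      use assms in \<open>auto simp del: iter_deriv.simps(2) intro: has_derivative_mult_right iter_deriv_has_derivative\<close>)+

lemma iter_deriv_const:
  assumes "open U"
  shows "smooth_on U (\<lambda>x. c)"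
    and "x \<in> U \<Longrightarrow> iter_deriv (\<lambda>x. c) vs x = (if vs = [] then c else 0)"
  by (rule iter_deriv_eqI[OF \<open>open U\<close>, where G = "\<lambda>vs x. if vs = [] then c else 0"]; auto)+

text \<open>These are the terms of the Leibniz rule: all distributions of the directions over two
  factors. A list rather than a set keeps multiplicities when directions repeat.\<close>

fun list_splits :: "'a list \<Rightarrow> ('a list \<times> 'a list) list" where
  "list_splits [] = [([], [])]"
| "list_splits (v # vs) =
     map (\<lambda>(us, ws). (v # us, ws)) (list_splits vs) @ map (\<lambda>(us, ws). (us, v # ws)) (list_splits vs)"

lemma length_list_splits: "length (list_splits vs) = 2 ^ length vs"
  by (induction vs) auto

lemma in_list_splits:
  "(us, ws) \<in> set (list_splits vs) \<Longrightarrow> set us \<subseteq> set vs \<and> set ws \<subseteq> set vs \<and> length us + length ws = length vs"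
proof (induction vs arbitrary: us ws)
  case (Cons v vs)
  then consider us' where "us = v # us'" "(us', ws) \<in> set (list_splits vs)"
    | ws' where "ws = v # ws'" "(us, ws') \<in> set (list_splits vs)"
    by auto
  then show ?case using Cons.IH by cases (simp, blast)+
qed simp

lemma has_derivative_sum_list:
  assumes "\<And>p. p \<in> set ps \<Longrightarrow> (F p has_derivative F' p) net"
  shows "((\<lambda>x. \<Sum>p\<leftarrow>ps. F p x) has_derivative (\<lambda>h. \<Sum>p\<leftarrow>ps. F' p h)) net"
  using assms by (induction ps) (auto intro: has_derivative_add)

lemma iter_deriv_mult:
  fixes f g :: "'a::real_normed_vector \<Rightarrow> real"
  assumes "open U" "smooth_on U f" "smooth_on U g"
  shows "smooth_on U (\<lambda>x. f x * g x)"
    and "x \<in> U \<Longrightarrow> iter_deriv (\<lambda>x. f x * g x) vs x =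
           (\<Sum>(us, ws)\<leftarrow>list_splits vs. iter_deriv f us x * iter_deriv g ws x)"
proof -
  define G where "G vs x = (\<Sum>p\<leftarrow>list_splits vs. iter_deriv f (fst p) x * iter_deriv g (snd p) x)" for vs x
  have G: "(G vs has_derivative (\<lambda>v. G (v # vs) x)) (at x)" if "x \<in> U" for vs x
  proof -
    have "((\<lambda>x. \<Sum>p\<leftarrow>list_splits vs. iter_deriv f (fst p) x * iter_deriv g (snd p) x) has_derivative
      (\<lambda>v. \<Sum>p\<leftarrow>list_splits vs. iter_deriv f (fst p) x * iter_deriv g (v # snd p) x
              + iter_deriv f (v # fst p) x * iter_deriv g (snd p) x)) (at x)"
      using that assms(2,3)
      by (intro has_derivative_sum_list has_derivative_mult iter_deriv_has_derivative)
    moreover have "G (v # vs) x = (\<Sum>p\<leftarrow>list_splits vs. iter_deriv f (fst p) x * iter_deriv g (v # snd p) x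
              + iter_deriv f (v # fst p) x * iter_deriv g (snd p) x)" for v
      by (simp add: G_def sum_list_addf o_def split_def)
    ultimately show ?thesis unfolding G_def[abs_def] by simp
  qed
  note eq = iter_deriv_eqI[OF \<open>open U\<close> _ G, where F = "\<lambda>x. f x * g x"]
  show "smooth_on U (\<lambda>x. f x * g x)" by (rule eq(1)) (simp add: G_def)
  show "x \<in> U \<Longrightarrow> iter_deriv (\<lambda>x. f x * g x) vs x =
           (\<Sum>(us, ws)\<leftarrow>list_splits vs. iter_deriv f us x * iter_deriv g ws x)"
    using eq(2)[of x vs] by (simp add: G_def split_def)
qed

section \<open>The ultradifferentiable classes\<close>

text \<open>The seminorm bound freed of suprema and quotients, with an explicit constant. The sign
  of \<open>C\<close> is demanded because an empty \<open>K\<close> would not enforce it.\<close>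

definition derivs_bounded_by :: "(nat \<Rightarrow> real) \<Rightarrow> 'a::real_normed_vector set \<Rightarrow> real \<Rightarrow> ('a \<Rightarrow> real) \<Rightarrow> real \<Rightarrow> bool" where
  "derivs_bounded_by M K \<rho> f C \<longleftrightarrow> C \<ge> 0 \<and> (\<forall>x\<in>K. \<forall>vs. (\<forall>v\<in>set vs. norm v \<le> 1) \<longrightarrow>
     \<bar>iter_deriv f vs x\<bar> \<le> C * \<rho> ^ length vs * (fact (length vs) * M (length vs)))"

lemma derivs_bounded_byD:
  assumes "derivs_bounded_by M K \<rho> f C" "x \<in> K" "\<forall>v\<in>set vs. norm v \<le> 1" "length vs = k"
  shows "\<bar>iter_deriv f vs x\<bar> \<le> C * \<rho> ^ k * (fact k * M k)"
  using assms by (auto simp: derivs_bounded_by_def)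

lemma derivs_bounded_by_mono:
  assumes "derivs_bounded_by M K \<rho> f C" "K' \<subseteq> K" "0 < \<rho>" "\<rho> \<le> \<rho>'"
    and "\<And>k. 0 < M k" "\<And>k. M k \<le> N k" "C \<le> C'"
  shows "derivs_bounded_by N K' \<rho>' f C'"
  unfolding derivs_bounded_by_def
proof (intro conjI ballI allI impI)
  show "C' \<ge> 0" using assms by (auto simp: derivs_bounded_by_def)
  fix x vs assume x: "x \<in> K'" "\<forall>v\<in>set vs. norm (v::'a) \<le> 1"
  have "\<bar>iter_deriv f vs x\<bar> \<le> C * \<rho> ^ length vs * (fact (length vs) * M (length vs))"
    using derivs_bounded_byD[OF assms(1)] assms(2) x by blast
  also have "\<dots> \<le> C' * \<rho>' ^ length vs * (fact (length vs) * N (length vs))"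
    using assms \<open>C' \<ge> 0\<close> less_imp_le[OF assms(5)] by (intro mult_mono power_mono) auto
  finally show "\<bar>iter_deriv f vs x\<bar> \<le> C' * \<rho>' ^ length vs * (fact (length vs) * N (length vs))" .
qed

lemma seminorm_finite_iff_derivs_bounded_by:
  fixes f :: "'a::euclidean_space \<Rightarrow> real"
  assumes sm: "smooth_on U f" and "open U" "K \<subseteq> U" "\<rho> > 0" and M: "\<And>k. M k > 0"
  shows "seminorm_finite M K \<rho> f \<longleftrightarrow> (\<exists>C. derivs_bounded_by M K \<rho> f C)"
proof -
  let ?V = "\<lambda>k. {vs::'a list. length vs = k \<and> (\<forall>v\<in>set vs. norm v \<le> 1)}"
  have ne: "?V k \<noteq> {}" for k by (auto intro!: exI[of _ "replicate k 0"])
  have den: "fact k * \<rho> ^ k * M k > 0" for k using M[of k] \<open>\<rho> > 0\<close> by simp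
  \<comment> \<open>A real \<open>SUP\<close> dominates its members only if they are bounded above;
    boundedness comes from the compact set \<open>{x}\<close>.\<close>
  have iter_le: "\<bar>iter_deriv f vs x\<bar> \<le> deriv_norm f k x" if "x \<in> K" "vs \<in> ?V k" for x vs k
  proof -
    have "{x} \<subseteq> U" using that \<open>K \<subseteq> U\<close> by auto
    obtain B where "\<And>vs. \<forall>v\<in>set vs. norm v \<le> 1 \<Longrightarrow> length vs = k \<Longrightarrow> \<bar>iter_deriv f vs x\<bar> \<le> B"
      using bounded_iter_deriv_compact[OF sm \<open>open U\<close> \<open>{x} \<subseteq> U\<close>, of k] by (metis compact_sing singletonI)
    then have "bdd_above ((\<lambda>vs. \<bar>iter_deriv f vs x\<bar>) ` ?V k)" by (intro bdd_aboveI2[where M = B]) simp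
    then show ?thesis unfolding deriv_norm_def using that(2) by (intro cSUP_upper)
  qed
  show ?thesis
  proof
    assume "seminorm_finite M K \<rho> f"
    then obtain C where C: "\<And>x k. x \<in> K \<Longrightarrow> deriv_norm f k x / (fact k * \<rho> ^ k * M k) \<le> C"
      unfolding seminorm_finite_def bdd_above_def by blast
    have "derivs_bounded_by M K \<rho> f \<bar>C\<bar>" unfolding derivs_bounded_by_def
    proof (intro conjI ballI allI impI)
      fix x vs assume x: "x \<in> K" "\<forall>v\<in>set vs. norm (v::'a) \<le> 1"
      let ?k = "length vs"
      have "\<bar>iter_deriv f vs x\<bar> \<le> deriv_norm f ?k x" using x by (intro iter_le) auto
      also have "\<dots> \<le> C * (fact ?k * \<rho> ^ ?k * M ?k)"
        using C[OF x(1), of ?k] by (simp only: pos_divide_le_eq[OF den])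
      also have "\<dots> \<le> \<bar>C\<bar> * (fact ?k * \<rho> ^ ?k * M ?k)"
        using den[of ?k] by (intro mult_right_mono) auto
      finally show "\<bar>iter_deriv f vs x\<bar> \<le> \<bar>C\<bar> * \<rho> ^ ?k * (fact ?k * M ?k)" by (simp only: ac_simps)
    qed simp
    then show "\<exists>C. derivs_bounded_by M K \<rho> f C" ..
  next
    assume "\<exists>C. derivs_bounded_by M K \<rho> f C"
    then obtain C where C: "derivs_bounded_by M K \<rho> f C" ..
    have "deriv_norm f k x / (fact k * \<rho> ^ k * M k) \<le> C" if "x \<in> K" for x k
    proof -
      have "deriv_norm f k x \<le> C * \<rho> ^ k * (fact k * M k)"
        unfolding deriv_norm_def using derivs_bounded_byD[OF C that] by (intro cSUP_least ne) auto
      then show ?thesis unfolding pos_divide_le_eq[OF den] by (simp only: ac_simps)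
    qed
    then show "seminorm_finite M K \<rho> f" unfolding seminorm_finite_def by (auto intro!: bdd_aboveI)
  qed
qed

lemma roumieu_iff:
  fixes f :: "'a::euclidean_space \<Rightarrow> real"
  assumes "open U" "\<And>k. M k > 0"
  shows "f \<in> roumieu M U \<longleftrightarrow> smooth_on U f \<and>
    (\<forall>K. compact K \<and> K \<subseteq> U \<longrightarrow> (\<exists>\<rho>>0. \<exists>C. derivs_bounded_by M K \<rho> f C))"
  using seminorm_finite_iff_derivs_bounded_by[where M = M and U = U and f = f, OF _ assms(1) _ _ assms(2)]
  unfolding roumieu_def mem_Collect_eq by metis

lemma beurling_iff:
  fixes f :: "'a::euclidean_space \<Rightarrow> real"
  assumes "open U" "\<And>k. M k > 0"
  shows "f \<in> beurling M U \<longleftrightarrow> smooth_on U f \<and>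
    (\<forall>K. compact K \<and> K \<subseteq> U \<longrightarrow> (\<forall>\<rho>>0. \<exists>C. derivs_bounded_by M K \<rho> f C))"
  using seminorm_finite_iff_derivs_bounded_by[where M = M and U = U and f = f, OF _ assms(1) _ _ assms(2)]
  unfolding beurling_def mem_Collect_eq by metis

text \<open>Lower bounds on \<open>M k\<close> are available only for large \<open>k\<close>. The
  finitely many remaining orders are bounded on the compact set and enter the constant through the
  sum \<open>D\<close>.\<close>

lemma derivs_bounded_by_eventually:
  fixes f :: "'a::euclidean_space \<Rightarrow> real"
  assumes sm: "smooth_on U f" and "open U" "K \<subseteq> U" "compact K" "\<rho> > 0" and M: "\<And>k. M k > 0" and "C \<ge> 0"
    and large: "\<And>x vs. x \<in> K \<Longrightarrow> \<forall>v\<in>set vs. norm v \<le> 1 \<Longrightarrow> length vs \<ge> N \<Longrightarrow>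
      \<bar>iter_deriv f vs x\<bar> \<le> C * \<rho> ^ length vs * (fact (length vs) * M (length vs))"
  shows "\<exists>C. derivs_bounded_by M K \<rho> f C"
proof -
  have "\<exists>b\<ge>0. \<forall>x\<in>K. \<forall>vs. (\<forall>v\<in>set vs. norm v \<le> 1) \<and> length vs = k \<longrightarrow> \<bar>iter_deriv f vs x\<bar> \<le> b" for k
    using bounded_iter_deriv_compact[OF assms(1-4), of k] by metis
  then obtain b where b: "\<And>k. b k \<ge> 0"
    "\<And>x vs. x \<in> K \<Longrightarrow> \<forall>v\<in>set vs. norm v \<le> 1 \<Longrightarrow> \<bar>iter_deriv f vs x\<bar> \<le> b (length vs)" by metis
  define w where "w k = \<rho> ^ k * (fact k * M k)" for k
  have w: "w k > 0" for k using M[of k] \<open>\<rho> > 0\<close> by (simp add: w_def)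
  define D where "D = (\<Sum>k<N. b k / w k)"
  have "D \<ge> 0" unfolding D_def using b(1) w by (intro sum_nonneg divide_nonneg_pos) auto
  have "derivs_bounded_by M K \<rho> f (C + D)" unfolding derivs_bounded_by_def
  proof (intro conjI ballI allI impI)
    fix x vs assume x: "x \<in> K" "\<forall>v\<in>set vs. norm (v::'a) \<le> 1"
    let ?k = "length vs"
    have "\<bar>iter_deriv f vs x\<bar> \<le> (C + D) * w ?k"
    proof (cases "?k < N")
      case True
      have "b ?k / w ?k \<le> D" unfolding D_def
        using True b(1) w by (intro member_le_sum divide_nonneg_pos) auto
      then have "b ?k \<le> D * w ?k" using w[of ?k] by (simp add: pos_divide_le_eq)
      also have "\<dots> \<le> (C + D) * w ?k" using w[of ?k] \<open>C \<ge> 0\<close> by (intro mult_right_mono) auto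
      finally show ?thesis using b(2)[OF x] by simp
    next
      case False
      have "\<bar>iter_deriv f vs x\<bar> \<le> C * w ?k" using large[OF x] False by (simp add: w_def mult.assoc)
      also have "\<dots> \<le> (C + D) * w ?k" using w[of ?k] \<open>D \<ge> 0\<close> by (intro mult_right_mono) auto
      finally show ?thesis .
    qed
    then show "\<bar>iter_deriv f vs x\<bar> \<le> (C + D) * \<rho> ^ ?k * (fact ?k * M ?k)" by (simp add: w_def mult.assoc)
  qed (use \<open>C \<ge> 0\<close> \<open>D \<ge> 0\<close> in auto)
  then show ?thesis ..
qed

section \<open>Transfer of derivative bounds to the regularised sequence\<close>

context weight_sequence
begin

lemma derivs_bounded_by_M_bc:
  fixes f :: "'a::euclidean_space \<Rightarrow> real"
  assumes sm: "smooth_on U f" and U: "open U" "K \<subseteq> U" "compact K"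
    and "e > 0" and nbhd: "(\<Union>x\<in>K. cball x e) \<subseteq> U"
    and C: "derivs_bounded_by M (\<Union>x\<in>K. cball x e) \<rho> f C" and "\<rho> > 0"
    and L: "L > 0" "\<And>k. k \<ge> N \<Longrightarrow> L ^ k \<le> M k"
    and \<rho>: "exp 1 * max 1 (M 0) * real DIM('a) \<le> \<rho> * e * L"
  shows "\<exists>C. derivs_bounded_by (M_bc M) K (real DIM('a) * exp 3 * \<rho>) f C"
\<comment> \<open>\<open>Suc N\<close> rather than \<open>N\<close> guarantees \<open>k > 0\<close>,
  which the choice of \<open>p < k\<close> requires.\<close>
proof (rule derivs_bounded_by_eventually[OF sm U, where C = "2 ^ DIM('a) * C" and N = "Suc N"])
  show "real DIM('a) * exp 3 * \<rho> > 0" using \<open>\<rho> > 0\<close> by simp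
  have "C \<ge> 0" using C by (simp add: derivs_bounded_by_def)
  then show "2 ^ DIM('a) * C \<ge> 0" by simp
  fix x and vs :: "'a list" assume x: "x \<in> K" and vs: "\<forall>v\<in>set vs. norm v \<le> 1" "Suc N \<le> length vs"
  define k where "k = length vs"
  obtain t p q where t: "t > 0" "p < k" "k \<le> q"
    and q: "fact q * M q = t ^ (q - p) * (fact p * M p)"
    and k: "t ^ (k - p) * (fact p * M p) \<le> fact k * M_bc M k"
    and t0: "fact q * M q \<le> t ^ q * M 0"
    using M_bc_ge_interpolated[of k] vs(2) by (metis k_def less_le_trans zero_less_Suc)
  obtain bs :: "'a list" where bs: "set bs = Basis" "length bs = DIM('a)"
    using finite_distinct_list[OF finite_Basis] distinct_card by metis
  define d where "d = e / real DIM('a)"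
  have "d > 0" and bd: "real (length bs) * d = e" using \<open>e > 0\<close> by (simp_all add: d_def bs)
  \<comment> \<open>Take \<open>q\<close>-th roots in \<open>(L * q / exp 1) ^ q <= L ^ q * fact q
    <= fact q * M q <= t ^ q * M 0\<close>; \<open>max 1 (M 0)\<close> dominates every root of
    \<open>M 0\<close>.\<close>
  have t_ge: "L * real q \<le> exp 1 * max 1 (M 0) * t"
  proof -
    have "q > 0" using t by simp
    have "(L * real q) ^ q \<le> L ^ q * (exp 1 ^ q * fact q)"
      using L(1) power_le_exp_mult_fact[of q] by (simp add: power_mult_distrib)
    also have "\<dots> \<le> exp 1 ^ q * (fact q * M q)"
      using L(2)[of q] t vs(2) by (simp add: k_def mult.commute mult.left_commute)
    also have "\<dots> \<le> exp 1 ^ q * (t ^ q * M 0)" using t0 by simp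
    also have "\<dots> \<le> exp 1 ^ q * (t ^ q * max 1 (M 0) ^ q)"
    proof -
      have "M 0 \<le> max 1 (M 0)" by simp
      also have "\<dots> \<le> max 1 (M 0) ^ q" using \<open>q > 0\<close> by (intro self_le_power) auto
      finally show ?thesis using t(1) by simp
    qed
    also have "\<dots> = (exp 1 * max 1 (M 0) * t) ^ q" by (simp add: power_mult_distrib)
    finally have "(L * real q) ^ q \<le> (exp 1 * max 1 (M 0) * t) ^ q" .
    moreover have "0 \<le> L * real q" "0 \<le> exp 1 * max 1 (M 0) * t" using L(1) t(1) by simp_all
    ultimately show ?thesis using \<open>q > 0\<close> by (simp only: power_mono_iff)
  qed
  have q_le: "real q \<le> \<rho> * t * d"
  proof -
    have "(exp 1 * max 1 (M 0) * real DIM('a)) * (L * real q) \<le> (\<rho> * e * L) * (exp 1 * max 1 (M 0) * t)"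
      using mult_mono[OF \<rho> t_ge] L(1) \<open>\<rho> > 0\<close> \<open>e > 0\<close> by simp
    then have "(exp 1 * max 1 (M 0) * L) * (real DIM('a) * real q) \<le> (exp 1 * max 1 (M 0) * L) * (\<rho> * e * t)"
      by (simp only: ac_simps)
    then have "real DIM('a) * real q \<le> \<rho> * e * t"
      by (rule mult_left_le_imp_le) (use L(1) in auto)
    then show ?thesis by (simp add: d_def field_simps)
  qed
  have "\<bar>iter_deriv f us x\<bar> \<le> 2 ^ DIM('a) * C * (exp 3 * \<rho>) ^ k * (fact k * M_bc M k)"
    if us: "set us \<subseteq> Basis" "length us = k" for us
  proof -
    \<comment> \<open>The last \<open>p\<close> directions are frozen. The derivative along
      \<open>ps\<close> is the function to which interpolation between the orders 0 and
      \<open>q - p\<close> is applied, in the remaining \<open>k - p\<close> directions.\<close>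
    define ws ps where "ws = take (k - p) us" and "ps = drop (k - p) us"
    have split: "us = ws @ ps" "length ws = k - p" "length ps = p"
      using us t by (auto simp: ws_def ps_def)
    then have basis: "set ws \<subseteq> Basis" "set ps \<subseteq> Basis" using us by auto
    let ?A = "C * \<rho> ^ p * (fact p * M p)"
    have norm1: "\<forall>v\<in>set us. norm v \<le> 1" if "set us \<subseteq> Basis" for us :: "'a list" using that by auto
    have "\<bar>iter_deriv (iter_deriv f ps) ws x\<bar> \<le> 2 ^ length bs * ?A * (exp 3 * (\<rho> * t)) ^ length ws"
    proof (rule interpolation_along_directions[where n = "q - p" and d = d])
      show "smooth_on U (iter_deriv f ps)" using sm by (rule smooth_on_iter_deriv)
      show "cball x (real (length bs) * d) \<subseteq> U" unfolding bd using nbhd x by blast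
      show "real (q - p) \<le> \<rho> * t * d" using q_le by simp
      fix y assume "y \<in> cball x (real (length bs) * d)"
      then have y: "y \<in> (\<Union>x\<in>K. cball x e)" using bd x by auto
      show "\<bar>iter_deriv f ps y\<bar> \<le> ?A"
        using derivs_bounded_byD[OF C y norm1[OF basis(2)] split(3)] .
      fix us' :: "'a list" assume us': "set us' \<subseteq> Basis" "length us' = q - p"
      have "\<bar>iter_deriv f (us' @ ps) y\<bar> \<le> C * \<rho> ^ q * (fact q * M q)"
        using us' basis split t by (intro derivs_bounded_byD[OF C y norm1]) auto
      also have "\<dots> = C * (\<rho> ^ p * \<rho> ^ (q - p)) * (t ^ (q - p) * (fact p * M p))"
        using q t by (simp flip: power_add)
      also have "\<dots> = ?A * (\<rho> * t) ^ (q - p)" by (simp only: power_mult_distrib ac_simps)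
      finally show "\<bar>iter_deriv (iter_deriv f ps) us' y\<bar> \<le> ?A * (\<rho> * t) ^ (q - p)"
        by (simp only: iter_deriv_append)
    qed (use U bs basis split t \<open>\<rho> > 0\<close> \<open>d > 0\<close> in auto)
    also have "\<dots> = 2 ^ DIM('a) * C * (\<rho> ^ p * (exp 3 * \<rho>) ^ (k - p)) * (t ^ (k - p) * (fact p * M p))"
      by (simp add: bs split power_mult_distrib)
    also have "\<dots> \<le> 2 ^ DIM('a) * C * ((exp 3 * \<rho>) ^ p * (exp 3 * \<rho>) ^ (k - p)) * (fact k * M_bc M k)"
      using \<open>C \<ge> 0\<close> \<open>\<rho> > 0\<close> t(1) less_imp_le[OF M_pos[of p]]
      by (intro mult_mono[OF mult_left_mono[OF mult_right_mono[OF power_mono]] k]) simp_all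
    also have "(exp 3 * \<rho>) ^ p * (exp 3 * \<rho>) ^ (k - p) = (exp 3 * \<rho>) ^ k" using t by (simp flip: power_add)
    finally show ?thesis by (simp add: split(1) iter_deriv_append)
  qed
  then have "\<bar>iter_deriv f vs x\<bar> \<le> real DIM('a) ^ k * (2 ^ DIM('a) * C * (exp 3 * \<rho>) ^ k * (fact k * M_bc M k))"
    using vs(1) x U(2) by (intro abs_iter_deriv_le_Basis[OF sm U(1)]) (auto simp: k_def)
  then show "\<bar>iter_deriv f vs x\<bar> \<le> 2 ^ DIM('a) * C * (real DIM('a) * exp 3 * \<rho>) ^ length vs *
      (fact (length vs) * M_bc M (length vs))"
    by (simp add: k_def power_mult_distrib ac_simps)
qed (rule M_bc_pos)

lemma derivs_bounded_by_const:
  fixes U :: "'a::real_normed_vector set"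
  assumes "open U" "K \<subseteq> U" "\<rho> > 0"
  shows "derivs_bounded_by M K \<rho> (\<lambda>x. c) (\<bar>c\<bar> / M 0)"
  unfolding derivs_bounded_by_def
proof (intro conjI ballI allI impI)
  show "\<bar>c\<bar> / M 0 \<ge> 0" using M_pos[of 0] by simp
  fix x and vs :: "'a list" assume "x \<in> K"
  then have "x \<in> U" using assms by auto
  then have "iter_deriv (\<lambda>x. c) vs x = (if vs = [] then c else 0)" by (rule iter_deriv_const(2)[OF assms(1)])
  then show "\<bar>iter_deriv (\<lambda>x. c) vs x\<bar> \<le> \<bar>c\<bar> / M 0 * \<rho> ^ length vs * (fact (length vs) * M (length vs))"
    using M_pos[of 0] M_pos[of "length vs"] \<open>\<rho> > 0\<close> by simp
qed

text \<open>By supermultiplicativity all \<open>2 ^ k\<close> Leibniz terms obey the same bound, and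
  their number is absorbed by doubling \<open>\<rho>\<close>.\<close>

lemma derivs_bounded_by_mult_M_bc:
  assumes U: "open U" "K \<subseteq> U" and f: "smooth_on U f" "derivs_bounded_by (M_bc M) K \<rho> f C"
    and g: "smooth_on U g" "derivs_bounded_by (M_bc M) K \<rho> g D" and "\<rho> > 0"
  shows "derivs_bounded_by (M_bc M) K (2 * \<rho>) (\<lambda>x. f x * g x) (C * D * M_bc M 0)"
  unfolding derivs_bounded_by_def
proof (intro conjI ballI allI impI)
  have CD: "C \<ge> 0" "D \<ge> 0" using f g by (auto simp: derivs_bounded_by_def)
  then show "C * D * M_bc M 0 \<ge> 0" using M_bc_pos[of 0] by simp
  fix x vs assume x: "x \<in> K" "\<forall>v\<in>set vs. norm (v::'a) \<le> 1"
  let ?k = "length vs"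
  let ?b = "C * D * \<rho> ^ ?k * (M_bc M 0 * (fact ?k * M_bc M ?k))"
  have summand: "\<bar>case p of (us, ws) \<Rightarrow> iter_deriv f us x * iter_deriv g ws x\<bar> \<le> ?b"
    if "p \<in> set (list_splits vs)" for p
  proof -
    obtain us ws where p: "p = (us, ws)" by (cases p)
    have sp: "set us \<subseteq> set vs" "set ws \<subseteq> set vs" "length us + length ws = ?k"
      using in_list_splits[of us ws vs] that by (simp_all add: p)
    let ?i = "length us" and ?j = "length ws"
    have "\<bar>iter_deriv f us x\<bar> * \<bar>iter_deriv g ws x\<bar> \<le>
        (C * \<rho> ^ ?i * (fact ?i * M_bc M ?i)) * (D * \<rho> ^ ?j * (fact ?j * M_bc M ?j))"
      using x sp CD \<open>\<rho> > 0\<close> less_imp_le[OF M_bc_pos]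
      by (intro mult_mono derivs_bounded_byD[OF f(2)] derivs_bounded_byD[OF g(2)]) auto
    also have "\<dots> = C * D * (\<rho> ^ ?i * \<rho> ^ ?j) * ((fact ?i * M_bc M ?i) * (fact ?j * M_bc M ?j))"
      by (simp only: ac_simps)
    also have "\<dots> \<le> C * D * (\<rho> ^ ?i * \<rho> ^ ?j) * (M_bc M 0 * (fact (?i + ?j) * M_bc M (?i + ?j)))"
      using CD \<open>\<rho> > 0\<close> by (intro mult_left_mono M_bc_supermultiplicative) auto
    also have "\<dots> = ?b" by (simp add: sp(3) flip: power_add)
    finally show ?thesis by (simp add: p abs_mult)
  qed
  have "x \<in> U" using x U by auto
  have "\<bar>iter_deriv (\<lambda>x. f x * g x) vs x\<bar> \<le>
      (\<Sum>p\<leftarrow>list_splits vs. \<bar>case p of (us, ws) \<Rightarrow> iter_deriv f us x * iter_deriv g ws x\<bar>)"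
    unfolding iter_deriv_mult(2)[OF U(1) f(1) g(1) \<open>x \<in> U\<close>] by (rule order_trans[OF sum_list_abs]) (simp add: o_def)
  also have "\<dots> \<le> (\<Sum>p\<leftarrow>list_splits vs. ?b)" using summand by (intro sum_list_mono)
  also have "\<dots> = 2 ^ ?k * ?b" by (simp add: sum_list_triv length_list_splits)
  also have "\<dots> = C * D * M_bc M 0 * (2 * \<rho>) ^ ?k * (fact ?k * M_bc M ?k)"
    by (simp add: power_mult_distrib)
  finally show "\<bar>iter_deriv (\<lambda>x. f x * g x) vs x\<bar> \<le> C * D * M_bc M 0 * (2 * \<rho>) ^ ?k * (fact ?k * M_bc M ?k)" .
qed

end

lemma derivs_bounded_by_add:
  assumes "open U" "K \<subseteq> U" "smooth_on U f" "smooth_on U g"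
    and f: "derivs_bounded_by M K \<rho> f C" and g: "derivs_bounded_by M K \<rho> g D"
  shows "derivs_bounded_by M K \<rho> (\<lambda>x. f x + g x) (C + D)"
  unfolding derivs_bounded_by_def
proof (intro conjI ballI allI impI)
  show "C + D \<ge> 0" using f g by (simp add: derivs_bounded_by_def)
  fix x vs assume x: "x \<in> K" "\<forall>v\<in>set vs. norm (v::'a) \<le> 1"
  then show "\<bar>iter_deriv (\<lambda>x. f x + g x) vs x\<bar> \<le> (C + D) * \<rho> ^ length vs * (fact (length vs) * M (length vs))"
    using derivs_bounded_byD[OF f x refl] derivs_bounded_byD[OF g x refl]
      iter_deriv_add(2)[OF assms(1,3,4), of x vs] assms(2)
    by (auto simp: distrib_right)
qed

lemma derivs_bounded_by_cmult:
  assumes "open U" "K \<subseteq> U" "smooth_on U f" "derivs_bounded_by M K \<rho> f C"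
  shows "derivs_bounded_by M K \<rho> (\<lambda>x. c * f x) (\<bar>c\<bar> * C)"
  unfolding derivs_bounded_by_def
proof (intro conjI ballI allI impI)
  show "\<bar>c\<bar> * C \<ge> 0" using assms by (simp add: derivs_bounded_by_def)
  fix x vs assume x: "x \<in> K" "\<forall>v\<in>set vs. norm (v::'a) \<le> 1"
  then show "\<bar>iter_deriv (\<lambda>x. c * f x) vs x\<bar> \<le> \<bar>c\<bar> * C * \<rho> ^ length vs * (fact (length vs) * M (length vs))"
    using mult_left_mono[OF derivs_bounded_byD[OF assms(4) x refl], of "\<bar>c\<bar>"]
      iter_deriv_cmult(2)[OF assms(1,3), of x c vs] assms(2)
    by (auto simp: abs_mult mult.assoc)
qed


section \<open>Equality of the classes and the algebra property\<close>

context weight_sequence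
begin

lemma derivs_bounded_by_from_M_bc:
  assumes "derivs_bounded_by (M_bc M) K \<rho> f C" "\<rho> > 0"
  shows "derivs_bounded_by M K \<rho> f C"
  using derivs_bounded_by_mono[OF assms(1) order_refl assms(2) order_refl M_bc_pos M_bc_le order_refl] .

lemma roumieu_eq_roumieu_M_bc:
  fixes U :: "'a::euclidean_space set"
  assumes "open U" and L: "L > 0" "\<And>k. k \<ge> N \<Longrightarrow> L ^ k \<le> M k"
  shows "roumieu M U = roumieu (M_bc M) U"
proof (intro set_eqI iffI)
  fix f assume "f \<in> roumieu M U"
  then have sm: "smooth_on U f"
    and bd: "\<And>K. compact K \<Longrightarrow> K \<subseteq> U \<Longrightarrow> \<exists>\<rho>>0. \<exists>C. derivs_bounded_by M K \<rho> f C"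
    by (auto simp: roumieu_iff[where M = M, OF \<open>open U\<close> M_pos])
  have "\<exists>\<rho>>0. \<exists>C. derivs_bounded_by (M_bc M) K \<rho> f C" if K: "compact K" "K \<subseteq> U" for K
  proof -
    obtain e where e: "e > 0" "(\<Union>x\<in>K. cball x e) \<subseteq> U"
      using compact_subset_open_imp_cball_epsilon_subset[OF K(1) \<open>open U\<close> K(2)] .
    obtain \<rho> C where \<rho>: "\<rho> > 0" "derivs_bounded_by M (\<Union>x\<in>K. cball x e) \<rho> f C"
      using bd[OF compact_minkowski_sum_cball[OF K(1)] e(2)] by blast
    \<comment> \<open>Here \<open>e\<close> and \<open>L\<close> are given, and a larger radius
      makes the balls wide enough for the interpolation.\<close>
    define \<rho>' where "\<rho>' = max \<rho> (exp 1 * max 1 (M 0) * real DIM('a) / (e * L))"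
    have "\<rho>' > 0" "\<rho> \<le> \<rho>'" using \<rho>(1) by (auto simp: \<rho>'_def)
    have "exp 1 * max 1 (M 0) * real DIM('a) / (e * L) \<le> \<rho>'" by (simp add: \<rho>'_def)
    then have "exp 1 * max 1 (M 0) * real DIM('a) \<le> \<rho>' * (e * L)"
      using e(1) L(1) by (subst (asm) pos_divide_le_eq) auto
    then have "exp 1 * max 1 (M 0) * real DIM('a) \<le> \<rho>' * e * L" by (simp only: mult.assoc)
    from derivs_bounded_by_M_bc[where N = N, OF sm \<open>open U\<close> K(2,1) e
        derivs_bounded_by_mono[OF \<rho>(2) order_refl \<rho>(1) \<open>\<rho> \<le> \<rho>'\<close> M_pos order_refl order_refl]
        \<open>\<rho>' > 0\<close> L this]
    show ?thesis using \<open>\<rho>' > 0\<close> by (rule_tac x = "real DIM('a) * exp 3 * \<rho>'" in exI) simp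
  qed
  then show "f \<in> roumieu (M_bc M) U" using sm by (simp add: roumieu_iff[where M = "M_bc M", OF \<open>open U\<close> M_bc_pos])
next
  fix f assume "f \<in> roumieu (M_bc M) U"
  then show "f \<in> roumieu M U"
    unfolding roumieu_iff[where M = "M_bc M", OF \<open>open U\<close> M_bc_pos] roumieu_iff[where M = M, OF \<open>open U\<close> M_pos]
    using derivs_bounded_by_from_M_bc by meson
qed

lemma beurling_eq_beurling_M_bc:
  fixes U :: "'a::euclidean_space set"
  assumes "open U" and L: "\<And>L. L > 0 \<Longrightarrow> \<exists>N. \<forall>k\<ge>N. L ^ k \<le> M k"
  shows "beurling M U = beurling (M_bc M) U"
proof (intro set_eqI iffI)
  fix f assume "f \<in> beurling M U"
  then have sm: "smooth_on U f"
    and bd: "\<And>K \<rho>. compact K \<Longrightarrow> K \<subseteq> U \<Longrightarrow> \<rho> > 0 \<Longrightarrow> \<exists>C. derivs_bounded_by M K \<rho> f C"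
    by (auto simp: beurling_iff[where M = M, OF \<open>open U\<close> M_pos])
  have "\<exists>C. derivs_bounded_by (M_bc M) K \<rho> f C" if K: "compact K" "K \<subseteq> U" and "\<rho> > 0" for K \<rho>
  proof -
    obtain e where e: "e > 0" "(\<Union>x\<in>K. cball x e) \<subseteq> U"
      using compact_subset_open_imp_cball_epsilon_subset[OF K(1) \<open>open U\<close> K(2)] .
    \<comment> \<open>Starting from \<open>\<sigma>\<close> compensates in advance for the
      dimensional loss, so that exactly the prescribed \<open>\<rho>\<close> results.\<close>
    define \<sigma> where "\<sigma> = \<rho> / (real DIM('a) * exp 3)"
    have "\<sigma> > 0" and \<sigma>: "real DIM('a) * exp 3 * \<sigma> = \<rho>" using \<open>\<rho> > 0\<close> by (simp_all add: \<sigma>_def)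
    obtain C where C: "derivs_bounded_by M (\<Union>x\<in>K. cball x e) \<sigma> f C"
      using bd[OF compact_minkowski_sum_cball[OF K(1)] e(2) \<open>\<sigma> > 0\<close>] by blast
    \<comment> \<open>With \<open>\<sigma>\<close> and \<open>e\<close> fixed, this is the growth
      rate for which the condition on \<open>\<sigma> * e * L\<close> holds with equality.\<close>
    define L where "L = exp 1 * max 1 (M 0) * real DIM('a) / (\<sigma> * e)"
    have "L > 0" using \<open>\<sigma> > 0\<close> e(1) by (simp add: L_def)
    obtain N where N: "\<And>k. k \<ge> N \<Longrightarrow> L ^ k \<le> M k" using L[OF \<open>L > 0\<close>] by blast
    have "exp 1 * max 1 (M 0) * real DIM('a) \<le> \<sigma> * e * L" using \<open>\<sigma> > 0\<close> e(1) by (simp add: L_def)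
    from derivs_bounded_by_M_bc[where N = N, OF sm \<open>open U\<close> K(2,1) e C \<open>\<sigma> > 0\<close> \<open>L > 0\<close> N this]
    show ?thesis unfolding \<sigma> .
  qed
  then show "f \<in> beurling (M_bc M) U" using sm by (simp add: beurling_iff[where M = "M_bc M", OF \<open>open U\<close> M_bc_pos])
next
  fix f assume "f \<in> beurling (M_bc M) U"
  then show "f \<in> beurling M U"
    unfolding beurling_iff[where M = "M_bc M", OF \<open>open U\<close> M_bc_pos] beurling_iff[where M = M, OF \<open>open U\<close> M_pos]
    using derivs_bounded_by_from_M_bc by meson
qed

lemma is_fun_algebra_roumieu:
  fixes U :: "'a::euclidean_space set"
  assumes "open U" and eq: "roumieu M U = roumieu (M_bc M) U"
  shows "is_fun_algebra (roumieu M U)"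
  unfolding is_fun_algebra_def
proof (intro conjI ballI allI)
  note iff = roumieu_iff[where M = M, OF \<open>open U\<close> M_pos] and iff_bc = roumieu_iff[where M = "M_bc M", OF \<open>open U\<close> M_bc_pos]
  show "(\<lambda>x. 1) \<in> roumieu M U"
    unfolding iff using iter_deriv_const(1)[OF \<open>open U\<close>] derivs_bounded_by_const[OF \<open>open U\<close>]
    by (metis zero_less_one)
  show "(\<lambda>x. c * f x) \<in> roumieu M U" if "f \<in> roumieu M U" for c f
    using that unfolding iff using iter_deriv_cmult(1)[OF \<open>open U\<close>] derivs_bounded_by_cmult[OF \<open>open U\<close>]
    by meson
  fix f g assume fg: "f \<in> roumieu M U" "g \<in> roumieu M U"
  then have sm: "smooth_on U f" "smooth_on U g" by (simp_all add: iff)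
  \<comment> \<open>The two functions come with different radii on \<open>K\<close>; bounds are
    monotone in the radius, so the maximum serves both.\<close>
  have common: "\<exists>\<rho>>0. \<exists>C D. derivs_bounded_by (M_bc M) K \<rho> f C \<and> derivs_bounded_by (M_bc M) K \<rho> g D"
    if K: "compact K" "K \<subseteq> U" for K
  proof -
    obtain \<rho> C where f: "\<rho> > 0" "derivs_bounded_by (M_bc M) K \<rho> f C"
      using fg(1) K unfolding eq iff_bc by blast
    obtain \<rho>' D where g: "\<rho>' > 0" "derivs_bounded_by (M_bc M) K \<rho>' g D"
      using fg(2) K unfolding eq iff_bc by blast
    have "derivs_bounded_by (M_bc M) K (max \<rho> \<rho>') f C"
      by (rule derivs_bounded_by_mono[OF f(2) order_refl f(1) _ M_bc_pos order_refl order_refl]) simp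
    moreover have "derivs_bounded_by (M_bc M) K (max \<rho> \<rho>') g D"
      by (rule derivs_bounded_by_mono[OF g(2) order_refl g(1) _ M_bc_pos order_refl order_refl]) simp
    ultimately show ?thesis using f(1) by (intro exI[of _ "max \<rho> \<rho>'"]) auto
  qed
  show "(\<lambda>x. f x + g x) \<in> roumieu M U"
    unfolding eq iff_bc using iter_deriv_add(1)[OF \<open>open U\<close> sm] common derivs_bounded_by_add[OF \<open>open U\<close> _ sm]
    by meson
  show "(\<lambda>x. f x * g x) \<in> roumieu M U"
    unfolding eq iff_bc
  proof (intro conjI allI impI)
    show "smooth_on U (\<lambda>x. f x * g x)" by (rule iter_deriv_mult(1)[OF \<open>open U\<close> sm])
    fix K assume K: "compact K \<and> K \<subseteq> U"
    then obtain \<rho> C D where \<rho>: "\<rho> > 0" "derivs_bounded_by (M_bc M) K \<rho> f C" "derivs_bounded_by (M_bc M) K \<rho> g D"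
      using common by blast
    then have "derivs_bounded_by (M_bc M) K (2 * \<rho>) (\<lambda>x. f x * g x) (C * D * M_bc M 0)"
      using K sm by (intro derivs_bounded_by_mult_M_bc[OF \<open>open U\<close>]) auto
    then show "\<exists>\<rho>>0. \<exists>C. derivs_bounded_by (M_bc M) K \<rho> (\<lambda>x. f x * g x) C"
      using \<rho>(1) by (intro exI[of _ "2 * \<rho>"]) auto
  qed
qed

lemma is_fun_algebra_beurling:
  fixes U :: "'a::euclidean_space set"
  assumes "open U" and eq: "beurling M U = beurling (M_bc M) U"
  shows "is_fun_algebra (beurling M U)"
  unfolding is_fun_algebra_def
proof (intro conjI ballI allI)
  note iff = beurling_iff[where M = M, OF \<open>open U\<close> M_pos] and iff_bc = beurling_iff[where M = "M_bc M", OF \<open>open U\<close> M_bc_pos]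
  show "(\<lambda>x. 1) \<in> beurling M U"
    unfolding iff using iter_deriv_const(1)[OF \<open>open U\<close>] derivs_bounded_by_const[OF \<open>open U\<close>] by meson
  show "(\<lambda>x. c * f x) \<in> beurling M U" if "f \<in> beurling M U" for c f
    using that unfolding iff using iter_deriv_cmult(1)[OF \<open>open U\<close>] derivs_bounded_by_cmult[OF \<open>open U\<close>]
    by meson
  fix f g assume fg: "f \<in> beurling M U" "g \<in> beurling M U"
  then have sm: "smooth_on U f" "smooth_on U g" by (simp_all add: iff)
  show "(\<lambda>x. f x + g x) \<in> beurling M U"
    using fg unfolding iff using iter_deriv_add(1)[OF \<open>open U\<close> sm] derivs_bounded_by_add[OF \<open>open U\<close> _ sm]
    by meson
  show "(\<lambda>x. f x * g x) \<in> beurling M U"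
    unfolding eq iff_bc
  proof (intro conjI allI impI)
    show "smooth_on U (\<lambda>x. f x * g x)" by (rule iter_deriv_mult(1)[OF \<open>open U\<close> sm])
    fix K and \<rho> :: real assume K: "compact K \<and> K \<subseteq> U" and "\<rho> > 0"
    \<comment> \<open>Halving offsets the factor 2 from the Leibniz rule.\<close>
    then have "\<rho> / 2 > 0" by simp
    obtain C where C: "derivs_bounded_by (M_bc M) K (\<rho> / 2) f C"
      using fg(1) K \<open>\<rho> / 2 > 0\<close> unfolding eq iff_bc by meson
    obtain D where D: "derivs_bounded_by (M_bc M) K (\<rho> / 2) g D"
      using fg(2) K \<open>\<rho> / 2 > 0\<close> unfolding eq iff_bc by meson
    have "derivs_bounded_by (M_bc M) K (2 * (\<rho> / 2)) (\<lambda>x. f x * g x) (C * D * M_bc M 0)"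
      using K by (intro derivs_bounded_by_mult_M_bc[OF \<open>open U\<close> _ sm(1) C sm(2) D \<open>\<rho> / 2 > 0\<close>]) simp
    then show "\<exists>C. derivs_bounded_by (M_bc M) K \<rho> (\<lambda>x. f x * g x) C" by auto
  qed
qed

end

text \<open>The growth condition compares the terms with those of the exponential series at
  \<open>\<bar>t\<bar> / L\<close>.\<close>

lemma weight_sequenceI:
  assumes M: "\<And>k. M k > 0" and L: "L > 0" "\<And>k. k \<ge> N \<Longrightarrow> L ^ k \<le> M k"
  shows "weight_sequence M"
proof
  show "(\<lambda>k. t ^ k / (fact k * M k)) \<longlonglongrightarrow> 0" for t
  proof (rule Lim_null_comparison)
    show "(\<lambda>k. inverse (fact k) * (\<bar>t\<bar> / L) ^ k) \<longlonglongrightarrow> 0"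
      by (intro summable_LIMSEQ_zero summable_exp)
    show "eventually (\<lambda>k. norm (t ^ k / (fact k * M k)) \<le> inverse (fact k) * (\<bar>t\<bar> / L) ^ k) sequentially"
      unfolding eventually_sequentially
    proof (intro exI allI impI)
      fix k assume "N \<le> k"
      have "norm (t ^ k / (fact k * M k)) = inverse (fact k) * (\<bar>t\<bar> ^ k / M k)"
        using M[of k] by (simp add: abs_mult power_abs divide_inverse)
      also have "\<dots> \<le> inverse (fact k) * (\<bar>t\<bar> ^ k / L ^ k)"
        using L(1) L(2)[OF \<open>N \<le> k\<close>] M[of k] by (intro mult_left_mono divide_left_mono) auto
      finally show "norm (t ^ k / (fact k * M k)) \<le> inverse (fact k) * (\<bar>t\<bar> / L) ^ k"
        by (simp add: power_divide)
    qed
  qed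
qed (rule M)

lemma eventually_power_le_of_root:
  fixes M :: "nat \<Rightarrow> real"
  assumes "\<And>k. M k > 0" "L > 0" "eventually (\<lambda>k. L < root k (M k)) sequentially"
  obtains N where "\<And>k. k \<ge> N \<Longrightarrow> L ^ k \<le> M k"
proof -
  obtain N where N: "\<And>k. k \<ge> N \<Longrightarrow> L < root k (M k)" using assms(3) by (auto simp: eventually_sequentially)
  \<comment> \<open>Order 0 is excluded because \<open>root 0\<close> is constantly 0 and does not
    invert the power.\<close>
  have "L ^ k \<le> M k" if "k \<ge> Suc N" for k
  proof -
    have "L ^ k \<le> root k (M k) ^ k" using N[of k] that \<open>L > 0\<close> by (intro power_mono) auto
    also have "\<dots> = M k" using that assms(1)[of k] by (intro real_root_pow_pos2) auto
    finally show ?thesis .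
  qed
  then show thesis by (rule that)
qed

theorem theorem2p15:
  fixes M :: "nat \<Rightarrow> real" and U :: "(real ^ 'n) set"
  assumes "\<forall>k. M k > 0" and "open U"
  shows "(liminf (\<lambda>k. ereal (root k (M k))) > 0 \<longrightarrow>
            roumieu M U = roumieu (M_bc M) U \<and> is_fun_algebra (roumieu M U))
       \<and> (filterlim (\<lambda>k. root k (M k)) at_top sequentially \<longrightarrow>
            beurling M U = beurling (M_bc M) U \<and> is_fun_algebra (beurling M U))"
proof (intro conjI impI)
  have M: "\<And>k. M k > 0" using assms(1) by blast
  {
    assume "liminf (\<lambda>k. ereal (root k (M k))) > 0"
    then obtain L where L: "0 < ereal L" "ereal L < liminf (\<lambda>k. ereal (root k (M k)))"
      using ereal_dense2 by blast
    have "L > 0" using L(1) by simp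
    moreover have "eventually (\<lambda>k. L < root k (M k)) sequentially"
      using less_LiminfD[OF L(2)] by simp
    ultimately obtain N where N: "\<And>k. k \<ge> N \<Longrightarrow> L ^ k \<le> M k"
      using eventually_power_le_of_root[where M = M, OF M] by blast
    interpret weight_sequence M by (rule weight_sequenceI[where M = M and N = N, OF M \<open>L > 0\<close> N])
    show eq: "roumieu M U = roumieu (M_bc M) U" by (rule roumieu_eq_roumieu_M_bc[where N = N, OF \<open>open U\<close> \<open>L > 0\<close> N])
    show "is_fun_algebra (roumieu M U)" by (rule is_fun_algebra_roumieu[OF \<open>open U\<close> eq])
  }
  {
    assume lim: "filterlim (\<lambda>k. root k (M k)) at_top sequentially"
    have pos: "\<exists>N. \<forall>k\<ge>N. L ^ k \<le> M k" if "L > 0" for L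
      using eventually_power_le_of_root[where M = M, OF M that] lim unfolding filterlim_at_top_dense by metis
    \<comment> \<open>The rate \<open>L = 1\<close> is enough to enter the locale; the equality of
      the classes draws on all rates in \<open>pos\<close>.\<close>
    then obtain N where "\<And>k. k \<ge> N \<Longrightarrow> 1 ^ k \<le> M k" by (metis zero_less_one)
    then interpret weight_sequence M by (intro weight_sequenceI[where M = M and N = N, OF M zero_less_one])
    show eq: "beurling M U = beurling (M_bc M) U" by (rule beurling_eq_beurling_M_bc[OF \<open>open U\<close> pos])
    show "is_fun_algebra (beurling M U)" by (rule is_fun_algebra_beurling[OF \<open>open U\<close> eq])
  }
qed

end
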